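(* Let $n\ge 1$ be a natural number and let $$\mathcal X:=\{(f,g)\in\operatorname{Aut}_+(\mathcal B_n)\times\operatorname{Aut}(\mathcal B_n):\tau_f,\tau_g\text{ generate }S_n\}.$$ Then the set $$\{(f,g)\in\mathcal X: f\text{ and }g\text{ freely generate a dense subgroup of }\operatorname{Aut}(\mathcal B_n)\}$$ is comeager in $\mathcal X$.
   Context: $\mathcal B_n$ is the poset with underlying set $\{1,\dots,n\}\times\mathbb Q$ and order $(k,p)\le(l,q)\iff k=l$ and $p\le q$. $S_n$ is the group of permutations of $\{1,\dots,n\}$. Every $f\in\operatorname{Aut}(\mathcal B_n)$ has the form $f(k,p)=(\tau_f(k),f_k(p))$ with a unique $\tau_f\in S_n$ and $f_1,\dots,f_n\in\operatorname{Aut}(\mathbb Q,\le)$. With $\pi_2(k,p)=p$, $\operatorname{Aut}_+(\mathcal B_n):=\{f\in\operatorname{Aut}(\mathcal B_n):\pi_2(f(k,p))>p\text{ for all }(k,p)\in\mathcal B_n\}$. $\operatorname{Aut}(\mathcal B_n)$ carries the topology with basic open sets $\{\bar f\in\operatorname{Aut}(\mathcal B_n): f\subset\bar f\}$, $f$ an isomorphism between finite subposets; $\mathcal X$ has the subspace topology of the product. "Comeager in $\mathcal X$" means that the complement in $\mathcal X$ is a countable union of nowhere dense subsets of $\mathcal X$. "$f$ and $g$ freely generate a dense subgroup" means that $w(f,g)\ne\operatorname{id}$ for every irreducible word $w(a,b)$ and $\langle f,g\rangle$ is dense. An irreducible word is an expression $c_1^{n_1}\cdots c_k^{n_k}$ with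 $k\ge1$, $c_i\in\{a,b\}$, $n_i\in\mathbb Z\setminus\{0\}$, $c_i\neq c_{i+1}$. *)

theory Defs
  imports "HOL-Analysis.Analysis" "HOL-Algebra.Sym_Groups"
begin

section \<open>The poset and its automorphism group\<close>

definition B_poset :: "nat \<Rightarrow> (nat \<times> rat) set" where
  "B_poset n = {1..n} \<times> UNIV"

definition B_le :: "nat \<times> rat \<Rightarrow> nat \<times> rat \<Rightarrow> bool" where
  "B_le x y \<longleftrightarrow> fst x = fst y \<and> snd x \<le> snd y"

text \<open>
  As with \<^const>\<open>sym_group\<close>, an automorphism of the poset \<open>(A, r)\<close> is represented by the total
  function that extends it by the identity outside \<open>A\<close>. Thus equality of functions is equality of
  automorphisms, and composition and identity are those of total functions.
\<close>

definition order_auts :: "'a set \<Rightarrow> ('a \<Rightarrow> 'a \<Rightarrow> bool) \<Rightarrow> ('a \<Rightarrow> 'a) set" where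
  "order_auts A r = {f. f permutes A \<and> (\<forall>x\<in>A. \<forall>y\<in>A. r (f x) (f y) \<longleftrightarrow> r x y)}"

definition Aut_B :: "nat \<Rightarrow> (nat \<times> rat \<Rightarrow> nat \<times> rat) monoid" where
  "Aut_B n = \<lparr>carrier = order_auts (B_poset n) B_le, mult = (\<circ>), one = id\<rparr>"

definition Aut_plus_B :: "nat \<Rightarrow> (nat \<times> rat \<Rightarrow> nat \<times> rat) set" where
  "Aut_plus_B n = {f \<in> carrier (Aut_B n). \<forall>x\<in>B_poset n. snd (f x) > snd x}"

definition tau :: "nat \<Rightarrow> (nat \<times> rat \<Rightarrow> nat \<times> rat) \<Rightarrow> nat \<Rightarrow> nat" where
  "tau n f = (THE t. t \<in> carrier (sym_group n) \<and>
     (\<exists>F. \<forall>k\<in>{1..n}. F k \<in> order_auts (UNIV :: rat set) (\<le>) \<and>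
        (\<forall>p. f (k, p) = (t k, F k p))))"

lemma tau_unique:
  assumes "f \<in> carrier (Aut_B n)"
  shows "\<exists>!t. t \<in> carrier (sym_group n) \<and>
     (\<exists>F. \<forall>k\<in>{1..n}. F k \<in> order_auts (UNIV :: rat set) (\<le>) \<and>
        (\<forall>p. f (k, p) = (t k, F k p)))"
proof -
  have perm: "f permutes B_poset n"
    using assms by (auto simp: Aut_B_def order_auts_def)
  have le: "B_le (f x) (f y) \<longleftrightarrow> B_le x y" if "x \<in> B_poset n" "y \<in> B_poset n" for x y
    using assms that by (auto simp: Aut_B_def order_auts_def)
  define t where "t k = (if k \<in> {1..n} then fst (f (k, 0)) else k)" for k
  have mem: "f (k, p) \<in> B_poset n \<longleftrightarrow> k \<in> {1..n}" for k p
    using permutes_in_image[OF perm, of "(k, p)"] by (simp add: B_poset_def)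
  have fst_f: "fst (f (k, p)) = t k" if k: "k \<in> {1..n}" for k p
    using le[of "(k, p)" "(k, 0)"] le[of "(k, 0)" "(k, p)"] k
    by (cases "p \<le> 0") (auto simp: B_poset_def B_le_def t_def)
  have inj_t: "k = l" if "k \<in> {1..n}" "l \<in> {1..n}" "t k = t l" for k l
  proof -
    have "B_le (f (k, 0)) (f (l, 0)) \<or> B_le (f (l, 0)) (f (k, 0))"
      using that fst_f by (auto simp: B_le_def)
    then show ?thesis
      using le[of "(k, 0)" "(l, 0)"] le[of "(l, 0)" "(k, 0)"] that
      by (auto simp: B_poset_def B_le_def)
  qed
  have t_in: "t k \<in> {1..n}" if "k \<in> {1..n}" for k
    using mem[of k 0] that by (auto simp: t_def B_poset_def mem_Times_iff)
  have inj: "inj_on t {1..n}"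
    using inj_t by (rule inj_onI)
  have "t ` {1..n} \<subseteq> {1..n}"
    using t_in by blast
  with inj have "t ` {1..n} = {1..n}"
    by (intro endo_inj_surj) auto
  with inj have "bij_betw t {1..n} {1..n}"
    by (simp add: bij_betw_def)
  then have t: "t permutes {1..n}"
    by (rule bij_imp_permutes) (simp only: t_def if_False)
  have F: "(\<lambda>p. snd (f (k, p))) \<in> order_auts UNIV (\<le>)" if k: "k \<in> {1..n}" for k
  proof -
    have mono: "snd (f (k, p)) \<le> snd (f (k, q)) \<longleftrightarrow> p \<le> q" for p q
      using le[of "(k, p)" "(k, q)"] k fst_f by (auto simp: B_poset_def B_le_def)
    have "inj (\<lambda>p. snd (f (k, p)))"
      by (rule injI) (metis mono order_antisym order_refl)
    moreover have "\<exists>p. q = snd (f (k, p))" for q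
    proof -
      obtain l p where lp: "f (l, p) = (t k, q)"
        using permutes_surj[OF perm] by (metis surj_def surj_pair)
      have "l \<in> {1..n}"
        using mem[of l p] lp t_in[OF k] by (auto simp: B_poset_def)
      then have "l = k"
        using inj_t[OF _ k] fst_f[of l p] lp by auto
      with lp show ?thesis by (metis snd_conv)
    qed
    ultimately have "bij (\<lambda>p. snd (f (k, p)))"
      by (auto simp: bij_def surj_def)
    then have "(\<lambda>p. snd (f (k, p))) permutes UNIV"
      by (rule bij_imp_permutes) simp
    then show ?thesis
      using mono by (simp add: order_auts_def)
  qed
  show ?thesis
  proof (rule ex1I[of _ t])
    show "t \<in> carrier (sym_group n) \<and> (\<exists>F. \<forall>k\<in>{1..n}. F k \<in> order_auts (UNIV :: rat set) (\<le>) \<and>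
        (\<forall>p. f (k, p) = (t k, F k p)))"
    proof (intro conjI exI ballI allI)
      fix k p assume k: "k \<in> {1..n}"
      show "f (k, p) = (t k, snd (f (k, p)))"
        using fst_f[OF k] by (simp add: prod_eq_iff)
    qed (use t F in \<open>simp_all add: sym_group_carrier\<close>)
  next
    fix s assume s: "s \<in> carrier (sym_group n) \<and> (\<exists>F. \<forall>k\<in>{1..n}.
        F k \<in> order_auts (UNIV :: rat set) (\<le>) \<and> (\<forall>p. f (k, p) = (s k, F k p)))"
    show "s = t"
    proof
      fix k
      show "s k = t k"
      proof (cases "k \<in> {1..n}")
        case True
        then show ?thesis
          using s by (auto simp: t_def)
      next
        case False
        then show ?thesis
          using s t by (metis permutes_not_in sym_group_carrier)
      qed
    qed
  qed
qed

lemma group_Aut_B: "group (Aut_B n)"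
proof (rule groupI)
  fix f assume f: "f \<in> carrier (Aut_B n)"
  then have p: "f permutes B_poset n"
    by (auto simp: Aut_B_def order_auts_def)
  have le: "\<And>x y. x \<in> B_poset n \<Longrightarrow> y \<in> B_poset n \<Longrightarrow> B_le (f x) (f y) \<longleftrightarrow> B_le x y"
    using f by (auto simp: Aut_B_def order_auts_def)
  have "B_le (inv' f x) (inv' f y) \<longleftrightarrow> B_le x y" if "x \<in> B_poset n" "y \<in> B_poset n" for x y
    using le[of "inv' f x" "inv' f y"] that permutes_in_image[OF permutes_inv[OF p]]
    by (simp add: permutes_inverses[OF p])
  then have "inv' f \<in> carrier (Aut_B n)"
    using permutes_inv[OF p] by (auto simp: Aut_B_def order_auts_def)
  moreover have "inv' f \<circ> f = id"
    using permutes_inv_o[OF p] by simp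
  ultimately show "\<exists>g\<in>carrier (Aut_B n). g \<otimes>\<^bsub>Aut_B n\<^esub> f = \<one>\<^bsub>Aut_B n\<^esub>"
    by (auto simp: Aut_B_def)
qed (auto simp: Aut_B_def order_auts_def permutes_compose permutes_id permutes_in_image comp_assoc)


section \<open>The topology\<close>

definition finite_partial_iso ::
  "'a set \<Rightarrow> ('a \<Rightarrow> 'a \<Rightarrow> bool) \<Rightarrow> 'a set \<Rightarrow> 'a set \<Rightarrow> ('a \<Rightarrow> 'a) \<Rightarrow> bool" where
  "finite_partial_iso A r D E p \<longleftrightarrow> finite D \<and> D \<subseteq> A \<and> E \<subseteq> A \<and> bij_betw p D E \<and>
     (\<forall>x\<in>D. \<forall>y\<in>D. r (p x) (p y) \<longleftrightarrow> r x y)"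

definition Aut_B_basis :: "nat \<Rightarrow> (nat \<times> rat \<Rightarrow> nat \<times> rat) set set" where
  "Aut_B_basis n = {{f \<in> carrier (Aut_B n). \<forall>x\<in>D. f x = p x} | D E p.
     finite_partial_iso (B_poset n) B_le D E p}"

definition Aut_B_top :: "nat \<Rightarrow> (nat \<times> rat \<Rightarrow> nat \<times> rat) topology" where
  "Aut_B_top n = topology_generated_by (Aut_B_basis n)"

lemma Aut_B_basis_restrict:
  assumes "h \<in> carrier (Aut_B n)" "finite D" "D \<subseteq> B_poset n"
  shows "{f \<in> carrier (Aut_B n). \<forall>x\<in>D. f x = h x} \<in> Aut_B_basis n"
proof -
  have p: "h permutes B_poset n"
    using assms by (auto simp: Aut_B_def order_auts_def)
  have "finite_partial_iso (B_poset n) B_le D (h ` D) h"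
    using assms permutes_in_image[OF p] permutes_inj_on[OF p]
    by (auto simp: finite_partial_iso_def bij_betw_def Aut_B_def order_auts_def subset_eq)
  then show ?thesis
    unfolding Aut_B_basis_def by blast
qed

lemma topspace_Aut_B_top [simp]: "topspace (Aut_B_top n) = carrier (Aut_B n)"
proof -
  have "carrier (Aut_B n) \<in> Aut_B_basis n"
    using Aut_B_basis_restrict[of id n "{}"] group.is_monoid[OF group_Aut_B]
      monoid.one_closed[of "Aut_B n"] by (simp add: Aut_B_def)
  then show ?thesis
    by (auto simp: Aut_B_top_def Aut_B_basis_def)
qed

lemma openin_Aut_B_top:
  "openin (Aut_B_top n) U \<longleftrightarrow> (arbitrary union_of (\<lambda>V. V \<in> Aut_B_basis n)) U"
proof
  have cover: "\<exists>W\<in>Aut_B_basis n. h \<in> W \<and> W \<subseteq> U"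
    if "generate_topology_on (Aut_B_basis n) U" "h \<in> U" for U h
    using that
  proof (induction arbitrary: h)
    case (Int U V)
    obtain W W' where W: "W \<in> Aut_B_basis n" "h \<in> W" "W \<subseteq> U"
      and W': "W' \<in> Aut_B_basis n" "h \<in> W'" "W' \<subseteq> V"
      using Int by blast
    obtain D E p where D: "finite_partial_iso (B_poset n) B_le D E p"
        "W = {f \<in> carrier (Aut_B n). \<forall>x\<in>D. f x = p x}"
      using W(1) unfolding Aut_B_basis_def by blast
    obtain D' E' q where D': "finite_partial_iso (B_poset n) B_le D' E' q"
        "W' = {f \<in> carrier (Aut_B n). \<forall>x\<in>D'. f x = q x}"
      using W'(1) unfolding Aut_B_basis_def by blast
    have "{f \<in> carrier (Aut_B n). \<forall>x\<in>D \<union> D'. f x = h x} \<in> Aut_B_basis n"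
      using D D' W(2) by (intro Aut_B_basis_restrict) (auto simp: finite_partial_iso_def)
    moreover have "{f \<in> carrier (Aut_B n). \<forall>x\<in>D \<union> D'. f x = h x} \<subseteq> U \<inter> V"
      using W W' D D' by auto
    moreover have "h \<in> {f \<in> carrier (Aut_B n). \<forall>x\<in>D \<union> D'. f x = h x}"
      using W(2) D(2) by simp
    ultimately show ?case
      by (intro bexI conjI)
  next
    case (UN K)
    then obtain V where "V \<in> K" "h \<in> V"
      by blast
    then show ?case
      using UN.IH[of V h] by (meson Sup_upper order_trans)
  next
    case (Basis V)
    then show ?case by (intro bexI[of _ V]) simp_all
  qed simp
  assume "openin (Aut_B_top n) U"
  then have gen: "generate_topology_on (Aut_B_basis n) U"
    by (simp add: Aut_B_top_def openin_topology_generated_by_iff)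
  show "(arbitrary union_of (\<lambda>V. V \<in> Aut_B_basis n)) U"
    unfolding arbitrary_union_of_alt
  proof
    fix h assume "h \<in> U"
    from cover[OF gen this] show "\<exists>V. V \<in> Aut_B_basis n \<and> h \<in> V \<and> V \<subseteq> U"
      unfolding Bex_def .
  qed
next
  assume "(arbitrary union_of (\<lambda>V. V \<in> Aut_B_basis n)) U"
  then obtain K where K: "K \<subseteq> Aut_B_basis n" "U = \<Union>K"
    by (auto simp: union_of_def)
  have "openin (Aut_B_top n) V" if "V \<in> K" for V
    using K(1) that unfolding Aut_B_top_def by (intro topology_generated_by_Basis) blast
  with K(2) show "openin (Aut_B_top n) U"
    by (simp add: openin_Union)
qed

definition X_set ::
  "nat \<Rightarrow> ((nat \<times> rat \<Rightarrow> nat \<times> rat) \<times> (nat \<times> rat \<Rightarrow> nat \<times> rat)) set" where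
  "X_set n = {(f, g). f \<in> Aut_plus_B n \<and> g \<in> carrier (Aut_B n) \<and>
     generate (sym_group n) {tau n f, tau n g} = carrier (sym_group n)}"

definition X_top ::
  "nat \<Rightarrow> ((nat \<times> rat \<Rightarrow> nat \<times> rat) \<times> (nat \<times> rat \<Rightarrow> nat \<times> rat)) topology" where
  "X_top n = subtopology (prod_topology (Aut_B_top n) (Aut_B_top n)) (X_set n)"

text \<open>The closure operator is written with its qualified name because HOL-Algebra
  declares conflicting infix notation for another closure.\<close>

definition nowhere_dense_in :: "'a topology \<Rightarrow> 'a set \<Rightarrow> bool" where
  "nowhere_dense_in T N \<longleftrightarrow> N \<subseteq> topspace T \<and> T interior_of (Abstract_Topology.closure_of T N) = {}"

definition comeager_in :: "'a topology \<Rightarrow> 'a set \<Rightarrow> bool" where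
  "comeager_in T S \<longleftrightarrow> S \<subseteq> topspace T \<and>
     (\<exists>\<N>. countable \<N> \<and> (\<forall>N\<in>\<N>. nowhere_dense_in T N) \<and> topspace T - S = \<Union>\<N>)"


section \<open>Words and free generation\<close>

datatype letter = Letter_a | Letter_b

text \<open>The list \<open>[(c\<^sub>1, n\<^sub>1), \<dots>, (c\<^sub>k, n\<^sub>k)]\<close> stands for the word
  \<open>c\<^sub>1\<^bsup>n\<^sub>1\<^esup> \<dots> c\<^sub>k\<^bsup>n\<^sub>k\<^esup>\<close>.\<close>

definition irreducible_word :: "(letter \<times> int) list \<Rightarrow> bool" where
  "irreducible_word w \<longleftrightarrow> w \<noteq> [] \<and> (\<forall>(c, k)\<in>set w. k \<noteq> 0) \<and> distinct_adj (map fst w)"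

definition eval_letter :: "'a \<Rightarrow> 'a \<Rightarrow> letter \<Rightarrow> 'a" where
  "eval_letter f g c = (case c of Letter_a \<Rightarrow> f | Letter_b \<Rightarrow> g)"

primrec eval_word :: "('a, 'm) monoid_scheme \<Rightarrow> 'a \<Rightarrow> 'a \<Rightarrow> (letter \<times> int) list \<Rightarrow> 'a" where
  "eval_word G f g [] = \<one>\<^bsub>G\<^esub>"
| "eval_word G f g (x # w) = (eval_letter f g (fst x) [^]\<^bsub>G\<^esub> snd x) \<otimes>\<^bsub>G\<^esub> eval_word G f g w"

definition freely_generate_dense ::
  "('a, 'm) monoid_scheme \<Rightarrow> 'a topology \<Rightarrow> 'a \<Rightarrow> 'a \<Rightarrow> bool" where
  "freely_generate_dense G T f g \<longleftrightarrow>
     (\<forall>w. irreducible_word w \<longrightarrow> eval_word G f g w \<noteq> \<one>\<^bsub>G\<^esub>) \<and>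
     Abstract_Topology.closure_of T (generate G {f, g}) = topspace T"

end

theory Submission
  imports Defs "HOL-Algebra.Multiplicative_Group"
begin

text \<open>
  A basic neighbourhood of a pair \<open>(f, g)\<close> fixes only finitely many values of \<open>f\<close> and \<open>g\<close>. Free generation
  of a dense subgroup amounts to countably many conditions: for each irreducible word \<open>w\<close> that
  \<open>w(f, g) \<noteq> id\<close>, and for each finite part of the graph of an automorphism \<open>h\<close> that some element of the
  generated subgroup extends it. Each condition is open, since the value of a word at a point
  depends on finitely many values of \<open>f\<close> and \<open>g\<close> (\<open>finitely_determined\<close>). It remains to meet each of them
  by changing \<open>f\<close> and \<open>g\<close> outside a given finite set \<open>D\<close>, without changing the permutations of
  columns. The freedom to do so lies far up in the columns: above \<open>D\<close> and its images any
  finite increasing behaviour can be prescribed (\<open>amalgamation\<close>).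

  To extend the restriction of \<open>h\<close> to a finite set \<open>E\<close> (\<open>dense_generating_extension\<close>), first change \<open>f\<close>
  so that it raises every second coordinate by at least some \<open>c > 0\<close>. Then a suitable power \<open>R\<close> of \<open>f\<close>
  preserves the columns and lifts any finite set above any bound. Because \<open>\<tau>\<^sub>f\<close> and \<open>\<tau>\<^sub>g\<close> generate \<open>S\<^sub>n\<close>,
  the generated subgroup contains some \<open>v\<close> that permutes the columns as \<open>g\<^sup>-\<^sup>1 h\<close> does. The sets \<open>R v E\<close>
  and \<open>R h E\<close> lie far up and their columns correspond under \<open>g\<close>, so \<open>g\<close> can be changed to map \<open>R v x\<close> to
  \<open>R h x\<close> for \<open>x \<in> E\<close>. Then \<open>R\<^sup>-\<^sup>1 g R v\<close> agrees with \<open>h\<close> on \<open>E\<close>.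

  To make a word nontrivial (\<open>free_extension\<close>), take an explicit ping-pong pair with the right
  permutations of columns (\<open>ping_pong_pair\<close>), on which \<open>w\<close> is nontrivial. The finitely many values
  responsible for this are shifted far up and prescribed there for \<open>f\<close> and \<open>g\<close>.
\<close>

text \<open>
  The columns are indexed by \<open>{1..n}\<close>; facts about these index sets should survive simplification
  in this form and not with \<open>Suc 0\<close> as lower bound.
\<close>

declare One_nat_def [simp del]

section \<open>Increasing bijections of an ordered field\<close>

lemma strict_mono_glue:
  fixes F1 F2 :: "'a::linorder \<Rightarrow> 'a"
  assumes F1: "strict_mono F1" and F2: "strict_mono F2" and eq: "F1 a = F2 a"
  shows "strict_mono (\<lambda>p. if p \<le> a then F1 p else F2 p)"
proof (rule strict_monoI)
  fix p q :: 'a assume "p < q"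
  then consider "q \<le> a" | "a < p" | "p \<le> a" "a < q"
    by force
  then show "(if p \<le> a then F1 p else F2 p) < (if q \<le> a then F1 q else F2 q)"
  proof cases
    case 3
    have "F1 p \<le> F2 a"
      using F1 3 eq by (metis strict_mono_less_eq)
    also have "F2 a < F2 q"
      using F2 3 by (simp add: strict_mono_less)
    finally show ?thesis using 3 by auto
  qed (use \<open>p < q\<close> F1 F2 in \<open>auto simp: strict_mono_less\<close>)
qed

lemma surj_glue:
  fixes F1 F2 :: "'a::linorder \<Rightarrow> 'a"
  assumes F1: "strict_mono F1" "surj F1" and F2: "strict_mono F2" "surj F2" and eq: "F1 a = F2 a"
  shows "surj (\<lambda>p. if p \<le> a then F1 p else F2 p)"
  unfolding surj_def
proof
  fix y
  show "\<exists>p. y = (if p \<le> a then F1 p else F2 p)"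
  proof (cases "y \<le> F1 a")
    case True
    obtain p where "y = F1 p" using F1(2) by (meson surjD)
    then show ?thesis using True F1(1) by (auto simp: strict_mono_less_eq intro!: exI[of _ p])
  next
    case False
    obtain p where "y = F2 p" using F2(2) by (meson surjD)
    then show ?thesis using False F2(1) eq by (auto simp: strict_mono_less_eq intro!: exI[of _ p])
  qed
qed

lemma shift_increasing_bij:
  fixes s :: "'a::linordered_field"
  shows "strict_mono (\<lambda>p. p + s)" "surj (\<lambda>p. p + s)"
  by (simp add: strict_mono_def) (rule surjI[of _ "\<lambda>p. p - s"], simp)

text \<open>
  Piecewise linear interpolation. The bound \<open>p + c \<le> F p\<close> passes from \<open>D\<close> to the whole line because
  a segment lies above a line of slope one as soon as its endpoints do, and because outside the range
  of \<open>D\<close> the map continues with slope one. With \<open>c > 0\<close> it excludes that an extension stalls below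
  a fixed point, including the irrational ones that a pointwise \<open>F p > p\<close> would still permit.
\<close>

lemma finite_increasing_extension:
  fixes \<phi> :: "'a::linordered_field \<Rightarrow> 'a"
  assumes "finite D" "strict_mono_on D \<phi>" "\<And>d. d \<in> D \<Longrightarrow> d + c \<le> \<phi> d"
  shows "\<exists>F. strict_mono F \<and> surj F \<and> (\<forall>d\<in>D. F d = \<phi> d) \<and> (\<forall>p. p + c \<le> F p)"
  using assms
proof (induction D rule: finite_linorder_max_induct)
  case empty
  show ?case
    by (intro exI[of _ "\<lambda>p. p + c"]) (simp add: shift_increasing_bij)
next
  case (insert b A)
  define s where "s = \<phi> b - b"
  note shift = shift_increasing_bij[of s]
  have cs: "c \<le> s"
    using insert.prems(2)[of b] by (simp add: s_def algebra_simps)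
  show ?case
  proof (cases "A = {}")
    case True
    then show ?thesis
      using shift cs by (intro exI[of _ "\<lambda>p. p + s"]) (auto simp: s_def)
  next
    case False
    define m where "m = Max A"
    have m: "m \<in> A" "\<And>a. a \<in> A \<Longrightarrow> a \<le> m" "m < b"
      using False insert.hyps by (auto simp: m_def)
    obtain F where F: "strict_mono F" "surj F" "\<forall>d\<in>A. F d = \<phi> d" "\<forall>p. p + c \<le> F p"
      using insert.IH insert.prems by (auto simp: strict_mono_on_def)
    define r where "r = (\<phi> b - \<phi> m) / (b - m)"
    have "\<phi> m < \<phi> b"
      using insert.prems(1) m by (auto simp: strict_mono_on_def)
    with m have r: "r > 0"
      by (simp add: r_def)
    define L where "L p = \<phi> m + r * (p - m)" for p
    have Lmono: "strict_mono L"
      using r by (auto simp: strict_mono_def L_def)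
    have Lsurj: "surj L"
      using r by (intro surjI[of _ "\<lambda>y. (y - \<phi> m) / r + m"]) (simp add: L_def)
    have Lb: "L b = b + s"
      using m by (simp add: L_def r_def s_def)
    have Lm: "F m = L m"
      using F m by (simp add: L_def)
    have Lc: "p + c \<le> L p" if "m \<le> p" "p \<le> b" for p
    proof -
      \<comment> \<open>The height of the segment over the line is a convex combination of its heights at \<open>m\<close> and \<open>b\<close>.\<close>
      have "(L p - p - c) * (b - m)
          = (b - p) * (\<phi> m - m - c) + (p - m) * (\<phi> b - b - c)"
        using m by (simp add: L_def r_def field_simps)
      also have "\<dots> \<ge> 0"
        using that insert.prems(2)[of m] insert.prems(2)[of b] m
        by (intro add_nonneg_nonneg mult_nonneg_nonneg) (auto simp: algebra_simps)
      finally have "0 \<le> L p - p - c"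
        using m by (simp only: zero_le_mult_iff) auto
      then show ?thesis
        by (simp add: algebra_simps)
    qed
    define G where "G p = (if p \<le> b then L p else p + s)" for p
    define H where "H p = (if p \<le> m then F p else G p)" for p
    have G: "strict_mono G" "surj G"
      unfolding G_def[abs_def]
      by (intro strict_mono_glue surj_glue Lmono Lsurj shift Lb)+
    have Gm: "F m = G m"
      using Lm m by (simp add: G_def)
    have "strict_mono H" "surj H"
      unfolding H_def[abs_def]
      by (intro strict_mono_glue surj_glue F G Gm)+
    moreover have "\<forall>d\<in>insert b A. H d = \<phi> d"
      using m F Lb by (auto simp: H_def G_def s_def)
    moreover have "\<forall>p. p + c \<le> H p"
      using F(4) Lc cs by (auto simp: H_def G_def)
    ultimately show ?thesis
      by blast
  qed
qed

section \<open>Automorphisms as maps of columns\<close>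

lemma mult_Aut_B [simp]: "f \<otimes>\<^bsub>Aut_B n\<^esub> g = f \<circ> g"
  and one_Aut_B [simp]: "\<one>\<^bsub>Aut_B n\<^esub> = id"
  by (simp_all add: Aut_B_def)

lemma Aut_B_closed:
  assumes "f \<in> carrier (Aut_B n)" "x \<in> B_poset n"
  shows "f x \<in> B_poset n"
  using assms permutes_in_image by (fastforce simp: Aut_B_def order_auts_def)

lemma Aut_B_comp: "f \<in> carrier (Aut_B n) \<Longrightarrow> g \<in> carrier (Aut_B n) \<Longrightarrow> f \<circ> g \<in> carrier (Aut_B n)"
  using monoid.m_closed[OF group.is_monoid[OF group_Aut_B]] by fastforce

lemma Aut_B_inv: "f \<in> carrier (Aut_B n) \<Longrightarrow> inv\<^bsub>Aut_B n\<^esub> f \<in> carrier (Aut_B n)"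
  by (rule group.inv_closed[OF group_Aut_B])

lemma Aut_B_inv_apply:
  assumes "f \<in> carrier (Aut_B n)"
  shows "(inv\<^bsub>Aut_B n\<^esub> f) (f x) = x" "f ((inv\<^bsub>Aut_B n\<^esub> f) x) = x"
  using group.l_inv[OF group_Aut_B assms] group.r_inv[OF group_Aut_B assms]
  by (metis mult_Aut_B one_Aut_B comp_apply id_apply)+

lemma Aut_B_columns:
  assumes "f \<in> carrier (Aut_B n)"
  shows tau_permutes: "tau n f permutes {1..n}"
    and fst_Aut_B: "x \<in> B_poset n \<Longrightarrow> fst (f x) = tau n f (fst x)"
    and snd_Aut_B_less: "k \<in> {1..n} \<Longrightarrow> p < q \<Longrightarrow> snd (f (k, p)) < snd (f (k, q))"
proof -
  let ?P = "\<lambda>t. t \<in> carrier (sym_group n) \<and>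
     (\<exists>F. \<forall>k\<in>{1..n}. F k \<in> order_auts (UNIV :: rat set) (\<le>) \<and>
        (\<forall>p. f (k, p) = (t k, F k p)))"
  have "?P (tau n f)"
    unfolding tau_def by (rule theI'[OF tau_unique[OF assms]])
  then obtain F where t: "tau n f permutes {1..n}"
    and F': "\<forall>k\<in>{1..n}. F k \<in> order_auts (UNIV :: rat set) (\<le>) \<and> (\<forall>p. f (k, p) = (tau n f k, F k p))"
    unfolding sym_group_carrier by blast
  then have F: "\<And>k. k \<in> {1..n} \<Longrightarrow> F k \<in> order_auts (UNIV :: rat set) (\<le>)"
      "\<And>k p. k \<in> {1..n} \<Longrightarrow> f (k, p) = (tau n f k, F k p)"
    by blast+
  show "tau n f permutes {1..n}"
    by fact
  show "x \<in> B_poset n \<Longrightarrow> fst (f x) = tau n f (fst x)"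
    using F(2) by (cases x) (auto simp: B_poset_def)
  show "k \<in> {1..n} \<Longrightarrow> p < q \<Longrightarrow> snd (f (k, p)) < snd (f (k, q))"
    using F(1)[of k] F(2)[of k] by (auto simp: order_auts_def less_le_not_le)
qed

lemma tau_eqI:
  assumes f: "f \<in> carrier (Aut_B n)" and t: "t permutes {1..n}"
    and eq: "\<And>k. k \<in> {1..n} \<Longrightarrow> fst (f (k, 0)) = t k"
  shows "tau n f = t"
proof
  fix k
  show "tau n f k = t k"
  proof (cases "k \<in> {1..n}")
    case True
    then show ?thesis
      using fst_Aut_B[OF f, of "(k, 0)"] eq by (simp add: B_poset_def)
  next
    case False
    then show ?thesis
      using t tau_permutes[OF f] by (metis permutes_not_in)
  qed
qed

lemma tau_group_hom: "group_hom (Aut_B n) (sym_group n) (tau n)"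
proof -
  have "tau n (f \<circ> g) = tau n f \<circ> tau n g"
    if "f \<in> carrier (Aut_B n)" "g \<in> carrier (Aut_B n)" for f g
  proof (rule tau_eqI)
    show "fst ((f \<circ> g) (k, 0)) = (tau n f \<circ> tau n g) k" if k: "k \<in> {1..n}" for k
      using k fst_Aut_B[OF \<open>f \<in> _\<close> Aut_B_closed[OF \<open>g \<in> _\<close>, of "(k, 0)"]]
        fst_Aut_B[OF \<open>g \<in> _\<close>, of "(k, 0)"]
      by (simp add: B_poset_def)
  qed (intro Aut_B_comp permutes_compose tau_permutes that)+
  then have "tau n \<in> hom (Aut_B n) (sym_group n)"
    by (auto simp: hom_def sym_group_carrier sym_group_mult tau_permutes)
  then show ?thesis
    by (simp add: group_hom_def group_hom_axioms_def group_Aut_B sym_group_is_group)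
qed

definition column_map ::
  "nat \<Rightarrow> (nat \<Rightarrow> nat) \<Rightarrow> (nat \<Rightarrow> rat \<Rightarrow> rat) \<Rightarrow> nat \<times> rat \<Rightarrow> nat \<times> rat" where
  "column_map n t F x = (if x \<in> B_poset n then (t (fst x), F (fst x) (snd x)) else x)"

lemma column_map_Aut_B:
  assumes t: "t permutes {1..n}"
    and F: "\<And>k. k \<in> {1..n} \<Longrightarrow> strict_mono (F k)" "\<And>k. k \<in> {1..n} \<Longrightarrow> surj (F k)"
  shows "column_map n t F \<in> carrier (Aut_B n)" "tau n (column_map n t F) = t"
proof -
  let ?f = "column_map n t F"
  have tinj: "t k = t l \<longleftrightarrow> k = l" for k l
    using permutes_inj[OF t] by (auto simp: inj_def)
  have Feq: "F k p = F k q \<longleftrightarrow> p = q" if "k \<in> {1..n}" for k p q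
    using strict_mono_eq[OF F(1)[OF that]] .
  have Fle: "F k p \<le> F k q \<longleftrightarrow> p \<le> q" if "k \<in> {1..n}" for k p q
    using strict_mono_less_eq[OF F(1)[OF that]] .
  have tin: "t k \<in> {1..n} \<longleftrightarrow> k \<in> {1..n}" for k
    by (rule permutes_in_image[OF t])
  have "bij_betw ?f (B_poset n) (B_poset n)"
  proof (rule bij_betwI')
    fix x y assume xy: "x \<in> B_poset n" "y \<in> B_poset n"
    then show "?f x = ?f y \<longleftrightarrow> x = y"
      by (cases x; cases y) (simp add: column_map_def tinj B_poset_def Feq del: atLeastAtMost_iff cong: conj_cong)
    show "?f x \<in> B_poset n"
      using xy by (simp add: column_map_def B_poset_def mem_Times_iff tin del: atLeastAtMost_iff)
  next
    fix y assume y: "y \<in> B_poset n"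
    obtain k where k: "t k = fst y"
      using surjD[OF permutes_surj[OF t], of "fst y"] by auto
    then have k': "k \<in> {1..n}"
      using y permutes_in_image[OF t, of k] by (auto simp: B_poset_def)
    then obtain p where "F k p = snd y"
      using surjD[OF F(2)[of k], of "snd y"] by auto
    then show "\<exists>x\<in>B_poset n. y = ?f x"
      using k k' by (intro bexI[of _ "(k, p)"]) (auto simp: column_map_def B_poset_def)
  qed
  then have "?f permutes B_poset n"
    by (rule bij_imp_permutes) (simp add: column_map_def)
  then show "?f \<in> carrier (Aut_B n)"
    by (simp add: Aut_B_def order_auts_def column_map_def B_le_def tinj B_poset_def Fle
        del: atLeastAtMost_iff cong: conj_cong)
  then show "tau n ?f = t"
    using t by (rule tau_eqI) (auto simp: column_map_def B_poset_def)
qed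

text \<open>
  The value \<open>1\<close> is thrown into the minimum so that an empty \<open>D\<close> also gives a positive bound.
\<close>

lemma finite_lower_displacement:
  fixes u :: "'a \<times> 'b::linordered_field \<Rightarrow> 'a \<times> 'b"
  assumes "finite D"
  obtains c where "\<And>x. x \<in> D \<Longrightarrow> snd x + c \<le> snd (u x)"
    "(\<forall>x\<in>D. snd x < snd (u x)) \<longrightarrow> c > 0"
proof -
  let ?S = "insert 1 ((\<lambda>x. snd (u x) - snd x) ` D)"
  have "Min ?S \<le> snd (u x) - snd x" if "x \<in> D" for x
    using assms that by (intro Min_le) auto
  then have "snd x + Min ?S \<le> snd (u x)" if "x \<in> D" for x
    using that by (simp add: algebra_simps)
  moreover have "(\<forall>x\<in>D. snd x < snd (u x)) \<longrightarrow> Min ?S > 0"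
    using assms by (subst Min_gr_iff) auto
  ultimately show thesis
    by (rule that)
qed

text \<open>
  Finite pieces of two automorphisms with the same permutation of columns have a common extension
  when one piece lies above the other both in its arguments and in its values: in every column the
  union of the two pieces is then a finite increasing map. All perturbations of \<open>f\<close> and \<open>g\<close> below are
  of this kind, with \<open>D\<close> carrying the values that must be kept and \<open>E\<close> the values to be prescribed.
\<close>

lemma amalgamation:
  assumes h: "h \<in> carrier (Aut_B n)" and \<psi>: "\<psi> \<in> carrier (Aut_B n)"
    and tau: "tau n \<psi> = tau n h"
    and D: "finite D" "D \<subseteq> B_poset n" and E: "finite E" "E \<subseteq> B_poset n"
    and above: "\<And>x y. x \<in> D \<Longrightarrow> y \<in> E \<Longrightarrow> snd x < snd y \<and> snd (h x) < snd (\<psi> y)"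
  obtains h' where "h' \<in> carrier (Aut_B n)" "tau n h' = tau n h"
    "\<And>x. x \<in> D \<Longrightarrow> h' x = h x" "\<And>x. x \<in> E \<Longrightarrow> h' x = \<psi> x"
    "(\<forall>x\<in>D. snd x < snd (h x)) \<and> (\<forall>x\<in>E. snd x < snd (\<psi> x)) \<longrightarrow>
       (\<exists>c>0. \<forall>x\<in>B_poset n. snd x + c \<le> snd (h' x))"
proof -
  define u where "u x = (if x \<in> D then h x else \<psi> x)" for x
  have uE: "u x = \<psi> x" if "x \<in> E" for x
    using above[of x x] that by (auto simp: u_def)
  have uD: "u x = h x" if "x \<in> D" for x
    using that by (simp add: u_def)
  obtain c where c: "\<And>x. x \<in> D \<union> E \<Longrightarrow> snd x + c \<le> snd (u x)"
    "(\<forall>x\<in>D \<union> E. snd x < snd (u x)) \<longrightarrow> c > 0"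
    by (rule finite_lower_displacement[OF finite_UnI[OF D(1) E(1)], of u]) (rule that)
  define S where "S k = {p. (k, p) \<in> D \<union> E}" for k
  have "\<exists>F. strict_mono F \<and> surj F \<and> (\<forall>p\<in>S k. F p = snd (u (k, p))) \<and> (\<forall>p. p + c \<le> F p)"
    if k: "k \<in> {1..n}" for k
  proof (rule finite_increasing_extension)
    have "S k \<subseteq> snd ` (D \<union> E)"
      by (force simp: S_def)
    then show "finite (S k)"
      using D E by (meson finite_UnI finite_imageI finite_subset)
    show "strict_mono_on (S k) (\<lambda>p. snd (u (k, p)))"
    proof (rule strict_mono_onI)
      fix p q assume pq: "p \<in> S k" "q \<in> S k" "p < q"
      then consider "(k, p) \<in> D" "(k, q) \<in> D" | "(k, p) \<in> E" "(k, q) \<in> E"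
        | "(k, p) \<in> D" "(k, q) \<in> E" | "(k, p) \<in> E" "(k, q) \<in> D"
        by (auto simp: S_def)
      then show "snd (u (k, p)) < snd (u (k, q))"
      proof cases
        case 4
        then show ?thesis using above[of "(k, q)" "(k, p)"] pq by auto
      qed (use above[of "(k, p)" "(k, q)"] snd_Aut_B_less[OF h k \<open>p < q\<close>]
            snd_Aut_B_less[OF \<psi> k \<open>p < q\<close>] in \<open>auto simp: uD uE\<close>)
    qed
    show "d + c \<le> snd (u (k, d))" if "d \<in> S k" for d
      using that c(1)[of "(k, d)"] by (simp add: S_def)
  qed
  then obtain F where F: "\<And>k. k \<in> {1..n} \<Longrightarrow> strict_mono (F k)" "\<And>k. k \<in> {1..n} \<Longrightarrow> surj (F k)"
      "\<And>k p. k \<in> {1..n} \<Longrightarrow> p \<in> S k \<Longrightarrow> F k p = snd (u (k, p))"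
      "\<And>k p. k \<in> {1..n} \<Longrightarrow> p + c \<le> F k p"
    by metis
  let ?f = "column_map n (tau n h) F"
  note f = column_map_Aut_B[OF tau_permutes[OF h] F(1,2)]
  have DE: "?f x = u x" if "x \<in> D \<union> E" for x
  proof -
    have x: "x \<in> B_poset n"
      using that D E by blast
    have "fst (u x) = tau n h (fst x)"
      using that x tau by (auto simp: uD uE fst_Aut_B[OF h] fst_Aut_B[OF \<psi>])
    moreover have "F (fst x) (snd x) = snd (u x)"
      using F(3)[of "fst x" "snd x"] that x by (auto simp: S_def B_poset_def)
    ultimately show ?thesis
      using x by (simp add: column_map_def prod_eq_iff)
  qed
  show thesis
  proof (rule that[OF f])
    have "c > 0" if "(\<forall>x\<in>D. snd x < snd (h x)) \<and> (\<forall>x\<in>E. snd x < snd (\<psi> x))"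
      using c(2) that by (auto simp: uD uE)
    moreover have "snd x + c \<le> snd (?f x)" if "x \<in> B_poset n" for x
      using F(4)[of "fst x"] that by (auto simp: column_map_def B_poset_def)
    ultimately show "(\<forall>x\<in>D. snd x < snd (h x)) \<and> (\<forall>x\<in>E. snd x < snd (\<psi> x)) \<longrightarrow>
       (\<exists>c>0. \<forall>x\<in>B_poset n. snd x + c \<le> snd (?f x))"
      by (intro impI exI[of _ c]) simp
  qed (simp_all add: DE uD uE)
qed

section \<open>Finitely determined operations on pairs of automorphisms\<close>

text \<open>
  This is continuity of \<open>\<Phi>\<close> as a map into the automorphism group, phrased through values: agreement
  with \<open>f\<close> and \<open>g\<close> on a finite set \<open>P\<close> forces agreement of the results on a given finite set \<open>E\<close>.
\<close>

definition finitely_determined :: "nat \<Rightarrow>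
    ((nat \<times> rat \<Rightarrow> nat \<times> rat) \<Rightarrow> (nat \<times> rat \<Rightarrow> nat \<times> rat) \<Rightarrow> (nat \<times> rat \<Rightarrow> nat \<times> rat)) \<Rightarrow> bool"
where
  "finitely_determined n \<Phi> \<longleftrightarrow> (\<forall>f\<in>carrier (Aut_B n). \<forall>g\<in>carrier (Aut_B n).
     \<Phi> f g \<in> carrier (Aut_B n) \<and>
     (\<forall>E. finite E \<and> E \<subseteq> B_poset n \<longrightarrow> (\<exists>P. finite P \<and> P \<subseteq> B_poset n \<and>
        (\<forall>f'\<in>carrier (Aut_B n). \<forall>g'\<in>carrier (Aut_B n).
           (\<forall>x\<in>P. f' x = f x \<and> g' x = g x) \<longrightarrow> (\<forall>x\<in>E. \<Phi> f' g' x = \<Phi> f g x)))))"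

lemma finitely_determined_closed:
  "finitely_determined n \<Phi> \<Longrightarrow> f \<in> carrier (Aut_B n) \<Longrightarrow> g \<in> carrier (Aut_B n) \<Longrightarrow>
     \<Phi> f g \<in> carrier (Aut_B n)"
  by (simp add: finitely_determined_def)

lemma finitely_determinedE:
  assumes "finitely_determined n \<Phi>" "f \<in> carrier (Aut_B n)" "g \<in> carrier (Aut_B n)"
    and "finite E" "E \<subseteq> B_poset n"
  obtains P where "finite P" "P \<subseteq> B_poset n"
    "\<And>f' g' x. f' \<in> carrier (Aut_B n) \<Longrightarrow> g' \<in> carrier (Aut_B n) \<Longrightarrow>
       (\<And>y. y \<in> P \<Longrightarrow> f' y = f y \<and> g' y = g y) \<Longrightarrow> x \<in> E \<Longrightarrow> \<Phi> f' g' x = \<Phi> f g x"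
proof -
  have "\<exists>P. finite P \<and> P \<subseteq> B_poset n \<and>
        (\<forall>f'\<in>carrier (Aut_B n). \<forall>g'\<in>carrier (Aut_B n).
           (\<forall>x\<in>P. f' x = f x \<and> g' x = g x) \<longrightarrow> (\<forall>x\<in>E. \<Phi> f' g' x = \<Phi> f g x))"
    using assms(1)[unfolded finitely_determined_def, rule_format, OF assms(2,3)] assms(4,5)
    by simp
  then obtain P where P: "finite P" "P \<subseteq> B_poset n"
    "\<forall>f'\<in>carrier (Aut_B n). \<forall>g'\<in>carrier (Aut_B n).
           (\<forall>x\<in>P. f' x = f x \<and> g' x = g x) \<longrightarrow> (\<forall>x\<in>E. \<Phi> f' g' x = \<Phi> f g x)"
    by (elim exE conjE)
  show ?thesis
    by (rule that[OF P(1,2)]) (use P(3) in simp)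
qed

lemma finitely_determinedI:
  assumes "\<And>f g. f \<in> carrier (Aut_B n) \<Longrightarrow> g \<in> carrier (Aut_B n) \<Longrightarrow> \<Phi> f g \<in> carrier (Aut_B n)"
    and "\<And>f g E. f \<in> carrier (Aut_B n) \<Longrightarrow> g \<in> carrier (Aut_B n) \<Longrightarrow> finite E \<Longrightarrow> E \<subseteq> B_poset n \<Longrightarrow>
      \<exists>P. finite P \<and> P \<subseteq> B_poset n \<and>
        (\<forall>f'\<in>carrier (Aut_B n). \<forall>g'\<in>carrier (Aut_B n).
           (\<forall>x\<in>P. f' x = f x \<and> g' x = g x) \<longrightarrow> (\<forall>x\<in>E. \<Phi> f' g' x = \<Phi> f g x))"
  shows "finitely_determined n \<Phi>"
  unfolding finitely_determined_def using assms by simp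

lemma finitely_determined_fst: "finitely_determined n (\<lambda>f g. f)"
  and finitely_determined_snd: "finitely_determined n (\<lambda>f g. g)"
  by (rule finitely_determinedI; blast)+

lemma finitely_determined_one: "finitely_determined n (\<lambda>f g. \<one>\<^bsub>Aut_B n\<^esub>)"
  by (rule finitely_determinedI) (use monoid.one_closed[OF group.is_monoid[OF group_Aut_B]] in auto)

lemma finitely_determined_mult:
  assumes \<Phi>: "finitely_determined n \<Phi>" and \<Psi>: "finitely_determined n \<Psi>"
  shows "finitely_determined n (\<lambda>f g. \<Phi> f g \<otimes>\<^bsub>Aut_B n\<^esub> \<Psi> f g)"
proof (rule finitely_determinedI)
  fix f g E assume f: "f \<in> carrier (Aut_B n)" and g: "g \<in> carrier (Aut_B n)"
    and E: "finite (E :: (nat \<times> rat) set)" "E \<subseteq> B_poset n"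
  obtain P where P: "finite P" "P \<subseteq> B_poset n"
    "\<And>f' g' x. f' \<in> carrier (Aut_B n) \<Longrightarrow> g' \<in> carrier (Aut_B n) \<Longrightarrow>
       (\<And>y. y \<in> P \<Longrightarrow> f' y = f y \<and> g' y = g y) \<Longrightarrow> x \<in> E \<Longrightarrow> \<Psi> f' g' x = \<Psi> f g x"
    by (rule finitely_determinedE[OF \<Psi> f g E]) blast
  have E': "finite (\<Psi> f g ` E)" "\<Psi> f g ` E \<subseteq> B_poset n"
    using E Aut_B_closed[OF finitely_determined_closed[OF \<Psi> f g]] by auto
  obtain Q where Q: "finite Q" "Q \<subseteq> B_poset n"
    "\<And>f' g' x. f' \<in> carrier (Aut_B n) \<Longrightarrow> g' \<in> carrier (Aut_B n) \<Longrightarrow>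
       (\<And>y. y \<in> Q \<Longrightarrow> f' y = f y \<and> g' y = g y) \<Longrightarrow> x \<in> \<Psi> f g ` E \<Longrightarrow> \<Phi> f' g' x = \<Phi> f g x"
    by (rule finitely_determinedE[OF \<Phi> f g E']) blast
  show "\<exists>P. finite P \<and> P \<subseteq> B_poset n \<and>
        (\<forall>f'\<in>carrier (Aut_B n). \<forall>g'\<in>carrier (Aut_B n).
           (\<forall>x\<in>P. f' x = f x \<and> g' x = g x) \<longrightarrow>
           (\<forall>x\<in>E. (\<Phi> f' g' \<otimes>\<^bsub>Aut_B n\<^esub> \<Psi> f' g') x = (\<Phi> f g \<otimes>\<^bsub>Aut_B n\<^esub> \<Psi> f g) x))"
    using P Q by (intro exI[of _ "P \<union> Q"]) auto
qed (use assms in \<open>simp add: Aut_B_comp finitely_determined_closed\<close>)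

lemma finitely_determined_inv:
  assumes \<Phi>: "finitely_determined n \<Phi>"
  shows "finitely_determined n (\<lambda>f g. inv\<^bsub>Aut_B n\<^esub> (\<Phi> f g))"
proof (rule finitely_determinedI)
  fix f g E assume f: "f \<in> carrier (Aut_B n)" and g: "g \<in> carrier (Aut_B n)"
    and E: "finite (E :: (nat \<times> rat) set)" "E \<subseteq> B_poset n"
  let ?h = "inv\<^bsub>Aut_B n\<^esub> (\<Phi> f g)"
  note fg = finitely_determined_closed[OF \<Phi> f g]
  \<comment> \<open>Two bijections that agree on the preimages of the points of \<open>E\<close> have inverses that agree on \<open>E\<close>.\<close>
  have E': "finite (?h ` E)" "?h ` E \<subseteq> B_poset n"
    using E Aut_B_closed[OF Aut_B_inv[OF fg]] by auto
  obtain P where P: "finite P" "P \<subseteq> B_poset n"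
    "\<And>f' g' x. f' \<in> carrier (Aut_B n) \<Longrightarrow> g' \<in> carrier (Aut_B n) \<Longrightarrow>
       (\<And>y. y \<in> P \<Longrightarrow> f' y = f y \<and> g' y = g y) \<Longrightarrow> x \<in> ?h ` E \<Longrightarrow> \<Phi> f' g' x = \<Phi> f g x"
    by (rule finitely_determinedE[OF \<Phi> f g E']) blast
  have "(inv\<^bsub>Aut_B n\<^esub> (\<Phi> f' g')) x = ?h x"
    if f': "f' \<in> carrier (Aut_B n)" and g': "g' \<in> carrier (Aut_B n)"
      and eq: "\<And>y. y \<in> P \<Longrightarrow> f' y = f y \<and> g' y = g y" and x: "x \<in> E" for f' g' x
  proof -
    have "\<Phi> f' g' (?h x) = x"
      using P(3)[OF f' g' eq, of "?h x"] x by (simp add: Aut_B_inv_apply[OF fg])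
    then show ?thesis
      using Aut_B_inv_apply(1)[OF finitely_determined_closed[OF \<Phi> f' g'], of "?h x"] by simp
  qed
  with P(1,2) show "\<exists>P. finite P \<and> P \<subseteq> B_poset n \<and>
        (\<forall>f'\<in>carrier (Aut_B n). \<forall>g'\<in>carrier (Aut_B n).
           (\<forall>x\<in>P. f' x = f x \<and> g' x = g x) \<longrightarrow>
           (\<forall>x\<in>E. (inv\<^bsub>Aut_B n\<^esub> (\<Phi> f' g')) x = ?h x))"
    by (intro exI[of _ P]) simp
qed (use assms in \<open>simp add: Aut_B_inv finitely_determined_closed\<close>)

lemma finitely_determined_nat_pow:
  assumes "finitely_determined n \<Phi>"
  shows "finitely_determined n (\<lambda>f g. \<Phi> f g [^]\<^bsub>Aut_B n\<^esub> (k :: nat))"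
proof (induction k)
  case 0
  show ?case
    unfolding nat_pow_0 by (rule finitely_determined_one)
next
  case (Suc k)
  show ?case
    unfolding nat_pow_Suc by (rule finitely_determined_mult[OF Suc assms])
qed

lemma finitely_determined_int_pow:
  assumes "finitely_determined n \<Phi>"
  shows "finitely_determined n (\<lambda>f g. \<Phi> f g [^]\<^bsub>Aut_B n\<^esub> (k :: int))"
  using finitely_determined_nat_pow[OF assms]
    finitely_determined_inv[OF finitely_determined_nat_pow[OF assms]]
  by (cases "k < 0") (simp_all only: int_pow_def2 if_True if_False)

lemma finitely_determined_eval_word:
  "finitely_determined n (\<lambda>f g. eval_word (Aut_B n) f g w)"
proof (induction w)
  case Nil
  show ?case
    unfolding eval_word.simps by (rule finitely_determined_one)
next
  case (Cons a w)
  have "finitely_determined n (\<lambda>f g. eval_letter f g c)" for c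
    by (cases c) (simp_all add: eval_letter_def finitely_determined_fst finitely_determined_snd)
  then show ?case
    unfolding eval_word.simps
    by (intro finitely_determined_mult finitely_determined_int_pow Cons)
qed

text \<open>
  An element of the generated subgroup comes with a recipe that can be applied to other generators;
  this is what allows the generators to be perturbed without losing the element on a finite set.
\<close>

lemma generate_finitely_determined:
  assumes "v \<in> generate (Aut_B n) {f, g}"
  obtains \<Phi> where "finitely_determined n \<Phi>" "\<Phi> f g = v"
    "\<And>f' g'. \<Phi> f' g' \<in> generate (Aut_B n) {f', g'}"
proof -
  have letter: "\<exists>\<Phi>. finitely_determined n \<Phi> \<and> \<Phi> f g = h \<and> (\<forall>f' g'. \<Phi> f' g' \<in> {f', g'})"
    if "h \<in> {f, g}" for h
  proof (cases "h = f")
    case True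
    then show ?thesis
      by (intro exI[of _ "\<lambda>f g. f"]) (simp add: finitely_determined_fst)
  next
    case False
    with that show ?thesis
      by (intro exI[of _ "\<lambda>f g. g"]) (simp add: finitely_determined_snd)
  qed
  have "\<exists>\<Phi>. finitely_determined n \<Phi> \<and> \<Phi> f g = v \<and> (\<forall>f' g'. \<Phi> f' g' \<in> generate (Aut_B n) {f', g'})"
    using assms
  proof (induction v rule: generate.induct)
    case one
    show ?case
      by (rule exI[of _ "\<lambda>_ _. \<one>\<^bsub>Aut_B n\<^esub>"])
        (intro conjI allI finitely_determined_one generate.one refl)
  next
    case (incl h)
    from letter[OF this] obtain \<Phi> where \<Phi>: "finitely_determined n \<Phi>" "\<Phi> f g = h"
        "\<forall>f' g'. \<Phi> f' g' \<in> {f', g'}"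
      by (elim exE conjE)
    show ?case
      by (rule exI[of _ \<Phi>]) (intro conjI allI \<Phi>(1,2) generate.incl \<Phi>(3)[rule_format])
  next
    case (inv h)
    from letter[OF this] obtain \<Phi> where \<Phi>: "finitely_determined n \<Phi>" "\<Phi> f g = h"
        "\<forall>f' g'. \<Phi> f' g' \<in> {f', g'}"
      by (elim exE conjE)
    show ?case
      unfolding \<Phi>(2)[symmetric]
      by (rule exI[of _ "\<lambda>f g. inv\<^bsub>Aut_B n\<^esub> (\<Phi> f g)"])
        (intro conjI allI refl finitely_determined_inv \<Phi>(1) generate.inv \<Phi>(3)[rule_format])
  next
    case (eng u v)
    from eng.IH obtain \<Phi> \<Psi> where
      \<Phi>: "finitely_determined n \<Phi>" "\<Phi> f g = u" "\<forall>f' g'. \<Phi> f' g' \<in> generate (Aut_B n) {f', g'}" and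
      \<Psi>: "finitely_determined n \<Psi>" "\<Psi> f g = v" "\<forall>f' g'. \<Psi> f' g' \<in> generate (Aut_B n) {f', g'}"
      by (elim exE conjE)
    show ?case
      unfolding \<Phi>(2)[symmetric] \<Psi>(2)[symmetric]
      by (rule exI[of _ "\<lambda>f g. \<Phi> f g \<otimes>\<^bsub>Aut_B n\<^esub> \<Psi> f g"])
        (intro conjI allI refl finitely_determined_mult \<Phi>(1) \<Psi>(1) generate.eng
          \<Phi>(3)[rule_format] \<Psi>(3)[rule_format])
  qed
  then obtain \<Phi> where \<Phi>: "finitely_determined n \<Phi>" "\<Phi> f g = v"
      "\<forall>f' g'. \<Phi> f' g' \<in> generate (Aut_B n) {f', g'}"
    by (elim exE conjE)
  show ?thesis
    by (rule that[OF \<Phi>(1,2) \<Phi>(3)[rule_format]])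
qed

lemma eval_word_hom:
  assumes "group_hom G H \<phi>" "f \<in> carrier G" "g \<in> carrier G"
  shows "eval_word H (\<phi> f) (\<phi> g) w = \<phi> (eval_word G f g w)"
    and "eval_word G f g w \<in> carrier G"
proof -
  interpret group_hom G H \<phi> by fact
  have letter: "eval_letter f g c \<in> carrier G" "eval_letter (\<phi> f) (\<phi> g) c = \<phi> (eval_letter f g c)" for c
    using assms by (cases c; simp add: eval_letter_def)+
  have "eval_word H (\<phi> f) (\<phi> g) w = \<phi> (eval_word G f g w) \<and> eval_word G f g w \<in> carrier G"
    by (induction w) (simp_all add: letter hom_int_pow)
  then show "eval_word H (\<phi> f) (\<phi> g) w = \<phi> (eval_word G f g w)" "eval_word G f g w \<in> carrier G"
    by auto
qed

lemma (in group) conjugation_group_hom: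
  assumes "\<theta> \<in> carrier G"
  shows "group_hom G G (\<lambda>x. inv \<theta> \<otimes> x \<otimes> \<theta>)"
proof -
  have "\<theta> \<otimes> (inv \<theta> \<otimes> z) = z" if "z \<in> carrier G" for z
    using that assms by (simp add: m_assoc[symmetric])
  then have "inv \<theta> \<otimes> (x \<otimes> y) \<otimes> \<theta> = (inv \<theta> \<otimes> x \<otimes> \<theta>) \<otimes> (inv \<theta> \<otimes> y \<otimes> \<theta>)"
    if "x \<in> carrier G" "y \<in> carrier G" for x y
    using that assms by (simp add: m_assoc)
  then have "(\<lambda>x. inv \<theta> \<otimes> x \<otimes> \<theta>) \<in> hom G G"
    using assms by (auto simp: hom_def)
  then show ?thesis
    by (simp add: group_hom_def group_hom_axioms_def is_group)
qed

section \<open>Neighbourhoods and comeager sets\<close>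

lemma openin_Aut_B_iff:
  "openin (Aut_B_top n) U \<longleftrightarrow> U \<subseteq> carrier (Aut_B n) \<and>
     (\<forall>f\<in>U. \<exists>D. finite D \<and> D \<subseteq> B_poset n \<and>
        (\<forall>f'\<in>carrier (Aut_B n). (\<forall>x\<in>D. f' x = f x) \<longrightarrow> f' \<in> U))" (is "_ \<longleftrightarrow> ?R")
proof
  assume U: "openin (Aut_B_top n) U"
  show ?R
  proof (intro conjI ballI)
    show "U \<subseteq> carrier (Aut_B n)"
      using openin_subset[OF U] by simp
    fix f assume "f \<in> U"
    then obtain V where V: "V \<in> Aut_B_basis n" "f \<in> V" "V \<subseteq> U"
      using U unfolding openin_Aut_B_top arbitrary_union_of_alt by blast
    then obtain D E p where "finite_partial_iso (B_poset n) B_le D E p"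
        "V = {f \<in> carrier (Aut_B n). \<forall>x\<in>D. f x = p x}"
      unfolding Aut_B_basis_def by blast
    then show "\<exists>D. finite D \<and> D \<subseteq> B_poset n \<and>
        (\<forall>f'\<in>carrier (Aut_B n). (\<forall>x\<in>D. f' x = f x) \<longrightarrow> f' \<in> U)"
      using V by (intro exI[of _ D]) (auto simp: finite_partial_iso_def)
  qed
next
  assume R: ?R
  show "openin (Aut_B_top n) U"
    unfolding openin_Aut_B_top arbitrary_union_of_alt
  proof
    fix f assume f: "f \<in> U"
    from bspec[OF conjunct2[OF R] f] obtain D where D: "finite D" "D \<subseteq> B_poset n"
      "\<forall>f'\<in>carrier (Aut_B n). (\<forall>x\<in>D. f' x = f x) \<longrightarrow> f' \<in> U"
      by (elim exE conjE)
    have f': "f \<in> carrier (Aut_B n)"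
      using R f by (elim conjE subsetD)
    show "\<exists>V. V \<in> Aut_B_basis n \<and> f \<in> V \<and> V \<subseteq> U"
      using Aut_B_basis_restrict[OF f' D(1,2)] f' D(3)
      by (intro exI[of _ "{f' \<in> carrier (Aut_B n). \<forall>x\<in>D. f' x = f x}"]) auto
  qed
qed

lemma X_set_carrier:
  "(f, g) \<in> X_set n \<Longrightarrow> f \<in> carrier (Aut_B n)" "(f, g) \<in> X_set n \<Longrightarrow> g \<in> carrier (Aut_B n)"
  by (auto simp: X_set_def Aut_plus_B_def)

lemma topspace_X_top [simp]: "topspace (X_top n) = X_set n"
  using X_set_carrier by (fastforce simp: X_top_def)

text \<open>
  A condition on \<open>f\<close> and one on \<open>g\<close> are merged into a single finite set \<open>D\<close>, so that neighbourhoods of a pair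
  are given by agreement of both components on \<open>D\<close>.
\<close>

lemma openin_X_top_iff:
  "openin (X_top n) W \<longleftrightarrow> W \<subseteq> X_set n \<and>
     (\<forall>(f, g)\<in>W. \<exists>D. finite D \<and> D \<subseteq> B_poset n \<and>
        (\<forall>(f', g')\<in>X_set n. (\<forall>x\<in>D. f' x = f x \<and> g' x = g x) \<longrightarrow> (f', g') \<in> W))"
    (is "_ \<longleftrightarrow> ?R")
proof
  assume W: "openin (X_top n) W"
  then obtain V where V: "openin (prod_topology (Aut_B_top n) (Aut_B_top n)) V" "W = V \<inter> X_set n"
    unfolding X_top_def openin_subtopology by blast
  show ?R
  proof (intro conjI ballI)
    show "W \<subseteq> X_set n"
      using V by blast
    fix z assume z: "z \<in> W"
    obtain f g where fg: "z = (f, g)" by force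
    then have "(f, g) \<in> V"
      using z V(2) by simp
    from V(1)[unfolded openin_prod_topology_alt, rule_format, OF this]
    obtain U U' where U: "openin (Aut_B_top n) U" "openin (Aut_B_top n) U'"
        "f \<in> U" "g \<in> U'" "U \<times> U' \<subseteq> V"
      by (elim exE conjE)
    from U(1)[unfolded openin_Aut_B_iff, THEN conjunct2, THEN bspec, OF U(3)]
    obtain D where D: "finite D" "D \<subseteq> B_poset n"
        "\<forall>f'\<in>carrier (Aut_B n). (\<forall>x\<in>D. f' x = f x) \<longrightarrow> f' \<in> U"
      by (elim exE conjE)
    from U(2)[unfolded openin_Aut_B_iff, THEN conjunct2, THEN bspec, OF U(4)]
    obtain D' where D': "finite D'" "D' \<subseteq> B_poset n"
        "\<forall>g'\<in>carrier (Aut_B n). (\<forall>x\<in>D'. g' x = g x) \<longrightarrow> g' \<in> U'"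
      by (elim exE conjE)
    have "(f', g') \<in> W" if "(f', g') \<in> X_set n" "\<forall>x\<in>D \<union> D'. f' x = f x \<and> g' x = g x" for f' g'
    proof -
      have "f' \<in> U" "g' \<in> U'"
        using D(3) D'(3) X_set_carrier[OF that(1)] that(2) by simp_all
      then show ?thesis
        using U(5) V(2) that(1) by auto
    qed
    then show "case z of (f, g) \<Rightarrow> \<exists>D. finite D \<and> D \<subseteq> B_poset n \<and>
        (\<forall>(f', g')\<in>X_set n. (\<forall>x\<in>D. f' x = f x \<and> g' x = g x) \<longrightarrow> (f', g') \<in> W)"
      unfolding fg prod.case using D(1,2) D'(1,2) by (intro exI[of _ "D \<union> D'"]) auto
  qed
next
  assume R: ?R
  show "openin (X_top n) W"
  proof (subst openin_subopen, intro ballI)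
    fix z assume z: "z \<in> W"
    obtain f g where fg: "z = (f, g)" by force
    have fgW: "(f, g) \<in> W"
      using z fg by simp
    from bspec[OF conjunct2[OF R] fgW, unfolded prod.case]
    obtain D where D: "finite D" "D \<subseteq> B_poset n"
      "\<forall>(f', g')\<in>X_set n. (\<forall>x\<in>D. f' x = f x \<and> g' x = g x) \<longrightarrow> (f', g') \<in> W"
      by (elim exE conjE)
    have X: "(f, g) \<in> X_set n"
      using R fgW by (elim conjE subsetD)
    let ?U = "\<lambda>f. {f' \<in> carrier (Aut_B n). \<forall>x\<in>D. f' x = f x}"
    have "openin (Aut_B_top n) (?U h)" for h
      unfolding openin_Aut_B_iff using D(1,2) by auto
    then have "openin (prod_topology (Aut_B_top n) (Aut_B_top n)) (?U f \<times> ?U g)"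
      by (simp add: openin_prod_Times_iff)
    then have "openin (X_top n) ((?U f \<times> ?U g) \<inter> X_set n)"
      unfolding X_top_def by (rule openin_subtopology_Int)
    moreover have "z \<in> (?U f \<times> ?U g) \<inter> X_set n"
      using X fg X_set_carrier[OF X] by auto
    moreover have "(?U f \<times> ?U g) \<inter> X_set n \<subseteq> W"
      using D(3) by auto
    ultimately show "\<exists>T. openin (X_top n) T \<and> z \<in> T \<and> T \<subseteq> W"
      by (intro exI conjI)
  qed
qed

text \<open>
  Points outside \<open>S\<close> avoid some member of \<open>\<O>\<close>. The nowhere dense pieces are the complements of the
  members, cut down to the complement of \<open>S\<close> so that their union is exactly that complement.
\<close>

lemma comeager_inI:
  assumes S: "S \<subseteq> topspace T" and count: "countable \<O>"
    and opn: "\<And>V. V \<in> \<O> \<Longrightarrow> openin T V"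
    and dense: "\<And>V W. V \<in> \<O> \<Longrightarrow> openin T W \<Longrightarrow> W \<noteq> {} \<Longrightarrow> V \<inter> W \<noteq> {}"
    and inter: "topspace T \<inter> \<Inter>\<O> \<subseteq> S"
  shows "comeager_in T S"
  unfolding comeager_in_def
proof (intro conjI exI ballI)
  let ?N = "(\<lambda>V. topspace T - V - S) ` \<O>"
  show "S \<subseteq> topspace T" by fact
  show "countable ?N"
    using count by simp
  show "topspace T - S = \<Union>?N"
    using inter by blast
  fix N assume "N \<in> ?N"
  then obtain V where V: "V \<in> \<O>" "N = topspace T - V - S"
    by blast
  have "Abstract_Topology.closure_of T N \<subseteq> topspace T - V"
    using V opn by (intro closure_of_minimal) auto
  then have disj: "T interior_of (Abstract_Topology.closure_of T N) \<inter> V = {}"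
    using interior_of_subset[of T "Abstract_Topology.closure_of T N"] by blast
  have "T interior_of (Abstract_Topology.closure_of T N) = {}"
  proof (rule ccontr)
    assume "T interior_of (Abstract_Topology.closure_of T N) \<noteq> {}"
    from dense[OF V(1) openin_interior_of this] disj show False
      by (simp add: Int_commute)
  qed
  then show "nowhere_dense_in T N"
    using V by (auto simp: nowhere_dense_in_def)
qed

section \<open>A ping-pong pair\<close>

text \<open>
  On each interval \<open>[i, i + 1)\<close> between consecutive integers this is the Moebius map that fixes both
  endpoints and multiplies the odds \<open>t / (1 - t)\<close> of the fractional part \<open>t\<close> by \<open>a\<close>. Hence parameters
  multiply under composition, which gives all integer powers at once.
\<close>

definition odds_map :: "rat \<Rightarrow> rat \<Rightarrow> rat" where
  "odds_map a p = of_int \<lfloor>p\<rfloor> + a * frac p / (1 + (a - 1) * frac p)"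

lemma odds_denominator_pos:
  fixes a t :: rat
  assumes "a > 0" "0 \<le> t" "t < 1"
  shows "1 + (a - 1) * t > 0"
proof -
  have "1 + (a - 1) * t = (1 - t) + a * t"
    by (simp add: algebra_simps)
  moreover have "(1 - t) + a * t > 0"
    using assms by (intro add_pos_nonneg) auto
  ultimately show ?thesis by simp
qed

lemma odds_fraction_bounds:
  fixes a t :: rat
  assumes "a > 0" "0 \<le> t" "t < 1"
  shows "0 \<le> a * t / (1 + (a - 1) * t)" "a * t / (1 + (a - 1) * t) < 1"
  using assms odds_denominator_pos[OF assms] by (auto simp: divide_less_eq algebra_simps)

lemma frac_rat_bounds: "0 \<le> frac (p :: rat)" "frac p < 1"
  by (simp_all add: frac_lt_1)

lemma floor_odds_map: "a > 0 \<Longrightarrow> \<lfloor>odds_map a p\<rfloor> = \<lfloor>p\<rfloor>"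
  using odds_fraction_bounds[of a "frac p", OF _ frac_rat_bounds]
  by (auto simp: odds_map_def floor_eq_iff)

lemma frac_odds_map: "a > 0 \<Longrightarrow> frac (odds_map a p) = a * frac p / (1 + (a - 1) * frac p)"
  using floor_odds_map[of a p] by (simp add: frac_def[of "odds_map a p"]) (simp add: odds_map_def)

lemma odds_map_mult:
  assumes "a > 0" "b > 0"
  shows "odds_map a (odds_map b p) = odds_map (a * b) p"
proof -
  define t where "t = frac p"
  have t: "0 \<le> t" "t < 1"
    by (simp_all add: t_def frac_lt_1)
  define d where "d = 1 + (b - 1) * t"
  have d: "d > 0"
    unfolding d_def by (rule odds_denominator_pos) (use assms t in auto)
  have e: "d + (a - 1) * (b * t) > 0"
  proof -
    have "d + (a - 1) * (b * t) = 1 + (a * b - 1) * t"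
      by (simp add: d_def algebra_simps)
    then show ?thesis
      using odds_denominator_pos[of "a * b" t] assms t by simp
  qed
  have "a * (b * t / d) / (1 + (a - 1) * (b * t / d)) = a * (b * t) / (d + (a - 1) * (b * t))"
    using d e by (simp add: field_simps)
  also have "d + (a - 1) * (b * t) = 1 + (a * b - 1) * t"
    by (simp add: d_def algebra_simps)
  finally have "a * (b * t / d) / (1 + (a - 1) * (b * t / d)) = a * b * t / (1 + (a * b - 1) * t)"
    by (simp add: mult.assoc)
  then show ?thesis
    using assms by (simp add: odds_map_def[of a "odds_map b p"] odds_map_def[of "a * b"]
        floor_odds_map frac_odds_map t_def[symmetric] d_def[symmetric])
qed

lemma odds_map_1: "odds_map 1 p = p"
  by (simp add: odds_map_def frac_def)

lemma strict_mono_odds_map: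
  assumes a: "a > 0"
  shows "strict_mono (odds_map a)"
proof (rule strict_monoI)
  fix p q :: rat assume pq: "p < q"
  show "odds_map a p < odds_map a q"
  proof (cases "\<lfloor>p\<rfloor> = \<lfloor>q\<rfloor>")
    case True
    then have t: "frac p < frac q"
      using pq by (simp add: frac_def)
    let ?d = "\<lambda>t. 1 + (a - 1) * t :: rat"
    have d: "?d (frac p) > 0" "?d (frac q) > 0"
      using odds_denominator_pos[OF a frac_rat_bounds] by auto
    have "a * frac p * ?d (frac q) < a * frac q * ?d (frac p)"
      using a t by (simp add: algebra_simps)
    then have "a * frac p / ?d (frac p) < a * frac q / ?d (frac q)"
      using d by (simp add: divide_less_eq less_divide_eq mult.commute)
    then show ?thesis
      using True by (simp add: odds_map_def)
  next
    case False
    then have "\<lfloor>p\<rfloor> < \<lfloor>q\<rfloor>"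
      using pq floor_mono[of p q] by linarith
    then have "\<lfloor>odds_map a p\<rfloor> < \<lfloor>odds_map a q\<rfloor>"
      by (simp add: floor_odds_map a)
    then show ?thesis
      by (rule floor_less_cancel)
  qed
qed

lemma surj_odds_map:
  assumes "a > 0"
  shows "surj (odds_map a)"
  using assms by (intro surjI[of _ "odds_map (1 / a)"]) (simp add: odds_map_mult odds_map_1)

definition near_integers :: "rat \<Rightarrow> rat set" where
  "near_integers e = {p. \<exists>i :: int. \<bar>p - of_int i\<bar> < e}"

text \<open>
  A point at distance at least \<open>e\<close> from the integers has odds between about \<open>e\<close> and \<open>1 / e\<close>. A factor
  beyond \<open>1 / e\<^sup>2\<close> therefore pushes it close to the next integer above, and the inverse of such a
  factor close to the one below.
\<close>

lemma odds_map_attracts: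
  assumes e: "0 < e" "e < 1" and p: "p \<notin> near_integers e"
    and a: "0 < a" and large: "a \<ge> 1 + 1 / e\<^sup>2 \<or> 1 / a \<ge> 1 + 1 / e\<^sup>2"
  shows "odds_map a p \<in> near_integers e"
proof -
  define t where "t = frac p"
  have p_eq: "p = of_int \<lfloor>p\<rfloor> + t"
    by (simp add: t_def frac_def)
  have t: "0 \<le> t" "t < 1"
    by (simp_all add: t_def frac_lt_1)
  have te: "e \<le> t" "t \<le> 1 - e"
  proof -
    have "\<not> \<bar>p - of_int \<lfloor>p\<rfloor>\<bar> < e"
      using p unfolding near_integers_def by blast
    then show "e \<le> t"
      using t p_eq by auto
    have "\<not> \<bar>p - of_int (\<lfloor>p\<rfloor> + 1)\<bar> < e"
      using p unfolding near_integers_def by blast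
    then show "t \<le> 1 - e"
      using t p_eq by auto
  qed
  let ?d = "1 + (a - 1) * t"
  have d: "?d > 0"
    using a t by (rule odds_denominator_pos)
  note bounds = odds_fraction_bounds[OF a t]
  from large show ?thesis
  proof
    assume large: "a \<ge> 1 + 1 / e\<^sup>2"
    have "1 / e\<^sup>2 \<le> a - 1" "0 \<le> 1 / e\<^sup>2"
      using large by auto
    then have "0 \<le> a - 1"
      by linarith
    have "1 = e * (1 / e\<^sup>2 * e)"
      using e by (simp add: power2_eq_square)
    also have "\<dots> \<le> e * ((a - 1) * t)"
      using e \<open>0 \<le> a - 1\<close> \<open>1 / e\<^sup>2 \<le> a - 1\<close> te by (intro mult_left_mono mult_mono) auto
    finally have "1 \<le> e * ((a - 1) * t)" .
    then have "1 - t < e * ?d"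
      using e te by (simp add: algebra_simps)
    moreover have "1 - a * t / ?d = (1 - t) / ?d"
      using d by (simp add: field_simps)
    ultimately have "1 - a * t / ?d < e"
      using d by (simp add: divide_less_eq)
    then have "\<bar>odds_map a p - of_int (\<lfloor>p\<rfloor> + 1)\<bar> < e"
      using bounds by (simp add: odds_map_def t_def[symmetric])
    then show ?thesis
      unfolding near_integers_def by blast
  next
    assume large: "1 / a \<ge> 1 + 1 / e\<^sup>2"
    then have "1 / e\<^sup>2 < 1 / a"
      by simp
    then have ae: "a < e\<^sup>2"
      using a e by (simp add: field_simps)
    have "a * t \<le> a"
      using a t by (simp add: mult_left_le)
    also have "a < e * e"
      using ae by (simp add: power2_eq_square)
    also have "e * e \<le> e * ?d"
    proof -
      have "?d = (1 - t) + a * t"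
        by (simp add: algebra_simps)
      also have "\<dots> \<ge> e"
        using te a t by (simp add: add_increasing2)
      finally show ?thesis
        using e by simp
    qed
    finally have "a * t / ?d < e"
      using d by (simp add: divide_less_eq)
    then have "\<bar>odds_map a p - of_int \<lfloor>p\<rfloor>\<bar> < e"
      using abs_of_nonneg[OF bounds(1)] by (simp only: odds_map_def t_def[symmetric] add_diff_cancel_left')
    then show ?thesis
      unfolding near_integers_def by blast
  qed
qed

text \<open>
  If the second coordinate of \<open>f x\<close> depends only on that of \<open>x\<close>, through a one-parameter group \<open>A\<close>,
  then the powers of \<open>f\<close> are seen through \<open>A\<close>, whatever \<open>f\<close> does to the columns.
\<close>

lemma Aut_B_int_pow_action:
  assumes f: "f \<in> carrier (Aut_B n)"
    and A: "\<And>x. x \<in> B_poset n \<Longrightarrow> snd (f x) = A 1 (snd x)"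
    and A0: "\<And>p. A 0 p = p" and A_add: "\<And>i j p. A (i + j) p = A i (A j p)"
    and x: "x \<in> B_poset n"
  shows "snd ((f [^]\<^bsub>Aut_B n\<^esub> (m :: int)) x) = A m (snd x)"
proof -
  interpret group "Aut_B n" by (rule group_Aut_B)
  have nat: "snd ((f [^]\<^bsub>Aut_B n\<^esub> k) x) = A (int k) (snd x)" if "x \<in> B_poset n" for k :: nat and x
    using that
  proof (induction k arbitrary: x)
    case 0
    then show ?case by (simp add: A0)
  next
    case (Suc k)
    have "snd ((f [^]\<^bsub>Aut_B n\<^esub> Suc k) x) = snd ((f [^]\<^bsub>Aut_B n\<^esub> k) (f x))"
      by simp
    also have "\<dots> = A (int k) (A 1 (snd x))"
      using Suc Aut_B_closed[OF f] by (simp add: A)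
    also have "\<dots> = A (int (Suc k)) (snd x)"
      by (simp add: A_add[symmetric] add.commute)
    finally show ?case .
  qed
  show ?thesis
  proof (cases "m < 0")
    case False
    then have "int (nat m) = m"
      by simp
    then show ?thesis
      using nat[OF x, of "nat m"] False by (simp only: int_pow_def2 if_False)
  next
    case True
    let ?g = "f [^]\<^bsub>Aut_B n\<^esub> nat (- m)"
    have g: "?g \<in> carrier (Aut_B n)"
      using f by simp
    define y where "y = (inv\<^bsub>Aut_B n\<^esub> ?g) x"
    have y: "y \<in> B_poset n" "?g y = x"
      using Aut_B_closed[OF Aut_B_inv[OF g] x] Aut_B_inv_apply(2)[OF g] by (simp_all add: y_def)
    have "int (nat (- m)) = - m"
      using True by simp
    then have "A m (snd x) = A m (A (- m) (snd y))"
      using nat[OF y(1), of "nat (- m)"] by (simp only: y(2))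
    also have "\<dots> = snd y"
      using A_add[of m "- m"] A0 by simp
    finally show ?thesis
      using True by (simp only: int_pow_def2 if_True y_def)
  qed
qed

text \<open>
  A nonzero multiple of \<open>s\<close> of size at most a quarter leaves the \<open>e\<close>-neighbourhood of the integers: it
  is too large to stay near the same integer and too small to come near another one.
\<close>

lemma near_integers_shift:
  fixes s :: rat
  assumes s: "0 < s" and m: "m \<noteq> 0" "\<bar>of_int m * s\<bar> \<le> 1 / 4" and e: "2 * e < s" "e \<le> 1 / 4"
    and p: "p \<in> near_integers e"
  shows "p + of_int m * s \<notin> near_integers e"
proof
  assume "p + of_int m * s \<in> near_integers e"
  then obtain i j :: int where ij: "\<bar>p - of_int i\<bar> < e" "\<bar>p + of_int m * s - of_int j\<bar> < e"
    using p unfolding near_integers_def by blast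
  have "(of_int j :: rat) < of_int i + 1" "(of_int i :: rat) < of_int j + 1"
    using ij m(2) e unfolding abs_less_iff abs_le_iff by linarith+
  then have "j = i"
    by linarith
  then have "\<bar>of_int m * s\<bar> < 2 * e"
    using ij unfolding abs_less_iff by linarith
  moreover have "1 * s \<le> \<bar>of_int m * s\<bar>"
    unfolding abs_mult using s m(1) by (intro mult_mono) (auto simp: of_int_abs[symmetric] simp del: of_int_abs)
  ultimately show False
    using e by simp
qed

text \<open>
  The exponents of \<open>w\<close> are bounded by some \<open>M\<close>. On second coordinates let \<open>f\<close> be the shift by
  \<open>s = 1 / (4 M)\<close> and \<open>g\<close> an odds map with a huge factor. Nonzero powers of \<open>g\<close> take everything far from
  the integers to points near them, and the powers of \<open>f\<close> that occur in \<open>w\<close> move points near the integers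
  away from them. The starting point \<open>1 / 2\<close> remains far from the integers under all these powers of
  \<open>f\<close>, so no value of \<open>w\<close> can return to it. Since only second coordinates matter, the permutations of
  columns can be prescribed.
\<close>

lemma ping_pong_pair:
  assumes w: "irreducible_word w" and n: "n \<ge> 1"
    and t: "t permutes {1..n}" "u permutes {1..n}"
  obtains f g x where "f \<in> carrier (Aut_B n)" "g \<in> carrier (Aut_B n)"
    "tau n f = t" "tau n g = u" "\<And>x. x \<in> B_poset n \<Longrightarrow> snd x < snd (f x)"
    "x \<in> B_poset n" "eval_word (Aut_B n) f g w x \<noteq> x"
proof -
  define M where "M = Max (insert 1 ((\<lambda>a. \<bar>snd a\<bar>) ` set w))"
  have M: "\<bar>snd a\<bar> \<le> M" if "a \<in> set w" for a
    using that by (auto simp: M_def)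
  have M1: "M \<ge> 1"
    by (simp add: M_def)
  define s :: rat where "s = 1 / (4 * of_int M)"
  have s: "s > 0" "s \<le> 1 / 4"
    using M1 by (simp_all add: s_def field_simps)
  have ms: "\<bar>of_int m * s\<bar> \<le> 1 / 4" if "\<bar>m\<bar> \<le> M" for m
  proof -
    have "\<bar>of_int m * s\<bar> = of_int \<bar>m\<bar> / (4 * of_int M)"
      using M1 by (simp add: s_def abs_mult)
    also have "\<dots> \<le> of_int M / (4 * of_int M)"
      using that M1 by (intro divide_right_mono) auto
    also have "\<dots> = 1 / 4"
      using M1 by simp
    finally show ?thesis .
  qed
  define e where "e = s / 3"
  have e: "0 < e" "e < 1" "2 * e < s" "e \<le> 1 / 12"
    using s by (simp_all add: e_def)
  define L where "L = 1 + 1 / e\<^sup>2"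
  have L: "L > 1"
    using e by (simp add: L_def)
  define f where "f = column_map n t (\<lambda>_ p. p + s)"
  define g where "g = column_map n u (\<lambda>_. odds_map L)"
  have f: "f \<in> carrier (Aut_B n)" "tau n f = t"
    unfolding f_def using column_map_Aut_B[OF t(1) shift_increasing_bij] by auto
  have g: "g \<in> carrier (Aut_B n)" "tau n g = u"
    unfolding g_def using column_map_Aut_B[OF t(2) strict_mono_odds_map surj_odds_map] L by auto
  have f_pow: "snd ((f [^]\<^bsub>Aut_B n\<^esub> m) x) = snd x + of_int m * s" if "x \<in> B_poset n" for m :: int and x
    by (rule Aut_B_int_pow_action[OF f(1), where A = "\<lambda>m p. p + of_int m * s"])
       (use that in \<open>auto simp: f_def column_map_def algebra_simps\<close>)
  have g_pow: "snd ((g [^]\<^bsub>Aut_B n\<^esub> m) x) = odds_map (L powi m) (snd x)" if "x \<in> B_poset n" for m :: int and x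
    by (rule Aut_B_int_pow_action[OF g(1), where A = "\<lambda>m p. odds_map (L powi m) p"])
       (use that L in \<open>auto simp: g_def column_map_def odds_map_1 odds_map_mult power_int_add\<close>)
  have g_attracts: "snd ((g [^]\<^bsub>Aut_B n\<^esub> m) x) \<in> near_integers e"
    if "x \<in> B_poset n" "m \<noteq> 0" "snd x \<notin> near_integers e" for m :: int and x
  proof -
    have "L powi m \<ge> L \<or> 1 / L powi m \<ge> L"
    proof (cases "m > 0")
      case True
      then show ?thesis
        using power_int_increasing[of 1 m L] L by simp
    next
      case False
      then show ?thesis
        using power_int_increasing[of 1 "- m" L] L \<open>m \<noteq> 0\<close> by (simp add: power_int_minus inverse_eq_divide)
    qed
    then show ?thesis
      using that L e unfolding g_pow[OF that(1)] L_def[symmetric]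
      by (intro odds_map_attracts) (auto simp: L_def[symmetric])
  qed
  define x0 :: "nat \<times> rat" where "x0 = (1, 1 / 2)"
  have x0: "x0 \<in> B_poset n"
    using n by (simp add: x0_def B_poset_def)
  have x0_far: "snd x0 + of_int m * s \<notin> near_integers e" if "\<bar>m\<bar> \<le> M" for m
  proof
    assume "snd x0 + of_int m * s \<in> near_integers e"
    then obtain i :: int where i: "\<bar>1 / 2 + of_int m * s - of_int i\<bar> < e"
      unfolding near_integers_def x0_def by auto
    then have "of_int i > (0 :: rat)" "of_int i < (1 :: rat)"
      using ms[OF that] e(4) by (simp_all add: abs_if split: if_splits)
    then show False
      by simp
  qed
  let ?ev = "eval_word (Aut_B n) f g"
  have ev: "?ev v \<in> carrier (Aut_B n)" for v
    by (rule finitely_determined_closed[OF finitely_determined_eval_word f(1) g(1)])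
  \<comment> \<open>The invariant of the ping-pong: it locates the image of the starting point under a final segment
    of the word according to its first letter. After a power of \<open>f\<close> the shift is undone first, and
    the starting point is admitted for the case that the segment is this power alone.\<close>
  have path: "(case v of [] \<Rightarrow> True
      | (Letter_a, m) # _ \<Rightarrow> snd (?ev v x0) - of_int m * s \<in> insert (snd x0) (near_integers e)
      | (Letter_b, m) # _ \<Rightarrow> snd (?ev v x0) \<in> near_integers e)"
    if "\<forall>a\<in>set v. snd a \<noteq> 0 \<and> \<bar>snd a\<bar> \<le> M" "distinct_adj (map fst v)" for v
    using that
  proof (induction v)
    case Nil
    then show ?case by simp
  next
    case (Cons a v)
    obtain c m where a: "a = (c, m)" by force
    have m: "m \<noteq> 0"
      using Cons.prems a by auto
    define y where "y = ?ev v x0"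
    have y: "y \<in> B_poset n"
      unfolding y_def by (rule Aut_B_closed[OF ev x0])
    have ev_a: "snd (?ev ((Letter_a, m) # v) x0) = snd y + of_int m * s"
      using f_pow[OF y, of m] by (simp add: eval_letter_def y_def)
    have ev_b: "?ev ((Letter_b, m) # v) x0 = (g [^]\<^bsub>Aut_B n\<^esub> m) y"
      by (simp add: eval_letter_def y_def)
    have "distinct_adj (map fst v)"
      using Cons.prems(2) by (cases v) auto
    then have IH: "case v of [] \<Rightarrow> True
      | (Letter_a, m) # _ \<Rightarrow> snd y - of_int m * s \<in> insert (snd x0) (near_integers e)
      | (Letter_b, m) # _ \<Rightarrow> snd y \<in> near_integers e"
      unfolding y_def using Cons.IH Cons.prems(1) by simp
    show ?case
    proof (cases c)
      case Letter_a
      have "snd y \<in> insert (snd x0) (near_integers e)"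
      proof (cases v)
        case Nil
        then show ?thesis by (simp add: y_def)
      next
        case (Cons b v')
        then show ?thesis
          using IH Cons.prems(2) a Letter_a by (cases b; cases "fst b") auto
      qed
      then show ?thesis
        by (simp only: ev_a a Letter_a list.case prod.case letter.case add_diff_cancel_right')
    next
      case Letter_b
      have "snd y \<notin> near_integers e"
      proof (cases v)
        case Nil
        then show ?thesis
          using x0_far[of 0] M1 by (simp add: y_def)
      next
        case (Cons b v')
        obtain k where b: "b = (Letter_a, k)"
          using Cons.prems(2) a Letter_b Cons by (cases b; cases "fst b") auto
        have k: "k \<noteq> 0" "\<bar>k\<bar> \<le> M"
          using Cons.prems(1) Cons b by auto
        define q where "q = snd y - of_int k * s"
        have y_q: "snd y = q + of_int k * s"
          by (simp add: q_def)
        have "q \<in> insert (snd x0) (near_integers e)"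
          using IH Cons b by (simp add: q_def)
        then show ?thesis
          using x0_far[OF k(2)] near_integers_shift[OF s(1) k(1) ms[OF k(2)] e(3), of q] e(4)
          unfolding y_q by auto
      qed
      from g_attracts[OF y m this] show ?thesis
        by (simp only: ev_b a Letter_b list.case prod.case letter.case)
    qed
  qed
  have "?ev w x0 \<noteq> x0"
  proof
    assume fixed: "?ev w x0 = x0"
    obtain c m v where cm: "w = (c, m) # v"
      using w by (cases w) (auto simp: irreducible_word_def)
    have wM: "\<forall>a\<in>set w. snd a \<noteq> 0 \<and> \<bar>snd a\<bar> \<le> M" "distinct_adj (map fst w)"
      using w M by (auto simp: irreducible_word_def)
    have m: "m \<noteq> 0" "\<bar>m\<bar> \<le> M"
      using wM cm by auto
    show False
    proof (cases c)
      case Letter_a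
      then have "snd x0 - of_int m * s \<in> insert (snd x0) (near_integers e)"
        using path[OF wM] fixed cm by simp
      then show False
        using x0_far[of "- m"] m s by auto
    next
      case Letter_b
      then have "snd x0 \<in> near_integers e"
        using path[OF wM] fixed cm by simp
      then show False
        using x0_far[of 0] M1 by simp
    qed
  qed
  moreover have "snd x < snd (f x)" if "x \<in> B_poset n" for x
    using that s by (simp add: f_def column_map_def)
  ultimately show thesis
    using that f g x0 by blast
qed

section \<open>Realizing finite parts of automorphisms\<close>

lemma finite_strict_upper_bound:
  assumes "finite (S :: rat set)"
  obtains T where "\<And>p. p \<in> S \<Longrightarrow> p < T"
proof
  fix p assume "p \<in> S"
  then have "p \<le> Max (insert 0 S)"
    using assms by (intro Max_ge) auto
  then show "p < Max (insert 0 S) + 1"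
    by simp
qed

lemma Aut_plus_BI:
  assumes "f \<in> carrier (Aut_B n)" "\<exists>c>0. \<forall>x\<in>B_poset n. snd x + c \<le> snd (f x)"
  shows "f \<in> Aut_plus_B n"
proof -
  from assms(2) obtain c where c: "c > 0" "\<And>x. x \<in> B_poset n \<Longrightarrow> snd x + c \<le> snd (f x)"
    by auto
  have "snd x < snd (f x)" if "x \<in> B_poset n" for x
    using c(1) c(2)[OF that] by linarith
  then show ?thesis
    using assms(1) by (simp add: Aut_plus_B_def)
qed

lemma X_set_change:
  assumes "(f, g) \<in> X_set n" "f' \<in> Aut_plus_B n" "g' \<in> carrier (Aut_B n)"
    and "tau n f' = tau n f" "tau n g' = tau n g"
  shows "(f', g') \<in> X_set n"
  using assms by (simp add: X_set_def)

text \<open>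
  A word in the two permutations that gives \<open>\<rho>\<close> lifts to the same word in \<open>f\<close> and \<open>g\<close>.
\<close>

lemma generate_covers_permutations:
  assumes "(f, g) \<in> X_set n" "\<rho> permutes {1..n}"
  obtains v where "v \<in> generate (Aut_B n) {f, g}" "v \<in> carrier (Aut_B n)" "tau n v = \<rho>"
proof -
  interpret group_hom "Aut_B n" "sym_group n" "tau n"
    by (rule tau_group_hom)
  have fg: "{f, g} \<subseteq> carrier (Aut_B n)"
    using X_set_carrier[OF assms(1)] by auto
  have "\<rho> \<in> generate (sym_group n) (tau n ` {f, g})"
    using assms by (simp add: X_set_def sym_group_carrier)
  then obtain v where "v \<in> generate (Aut_B n) {f, g}" "\<rho> = tau n v"
    unfolding generate_img[OF fg] by (rule imageE)
  then show thesis
    using that[of v] G.generate_in_carrier[OF fg] by simp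
qed

lemma iterated_displacement:
  assumes r: "r \<in> carrier (Aut_B n)"
    and c: "\<And>x. x \<in> B_poset n \<Longrightarrow> snd x + c \<le> snd (r x)"
    and x: "x \<in> B_poset n"
  shows "snd x + of_nat j * c \<le> snd ((r [^]\<^bsub>Aut_B n\<^esub> j) x)"
  using x
proof (induction j arbitrary: x)
  case 0
  then show ?case by simp
next
  case (Suc j)
  have "snd x + of_nat (Suc j) * c \<le> snd (r x) + of_nat j * c"
    using c[OF Suc.prems] by (simp add: algebra_simps)
  also have "\<dots> \<le> snd ((r [^]\<^bsub>Aut_B n\<^esub> j) (r x))"
    by (rule Suc.IH[OF Aut_B_closed[OF r Suc.prems]])
  finally show ?case by simp
qed

text \<open>
  With \<open>R\<close> a high power of \<open>f'\<close> that keeps the columns, the element sought is \<open>R\<^sup>-\<^sup>1 g' R v\<close>. Here \<open>v\<close> is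
  an element of the group generated by \<open>f'\<close> and \<open>g\<close> that makes up for the difference between the
  column permutations of \<open>g\<close> and \<open>h\<close>. The points \<open>R (v x)\<close> and \<open>R (h x)\<close> for \<open>x \<in> E\<close> lie above
  everything that has been used so far, so \<open>g'\<close> may map the former to the latter.
\<close>

lemma dense_generating_extension:
  assumes X: "(f, g) \<in> X_set n" and D: "finite D" "D \<subseteq> B_poset n"
    and h: "h \<in> carrier (Aut_B n)" and E: "finite E" "E \<subseteq> B_poset n"
  obtains f' g' v where "(f', g') \<in> X_set n" "\<And>x. x \<in> D \<Longrightarrow> f' x = f x \<and> g' x = g x"
    "v \<in> generate (Aut_B n) {f', g'}" "\<And>x. x \<in> E \<Longrightarrow> v x = h x"
proof -
  interpret group_hom "Aut_B n" "sym_group n" "tau n"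
    by (rule tau_group_hom)
  have f: "f \<in> carrier (Aut_B n)" "\<And>x. x \<in> D \<Longrightarrow> snd x < snd (f x)" and g: "g \<in> carrier (Aut_B n)"
    using X D by (auto simp: X_set_def Aut_plus_B_def)
  \<comment> \<open>Powers of \<open>f\<close> itself may be bounded on a column; a uniform displacement makes those of \<open>f'\<close> reach
    arbitrarily high.\<close>
  obtain f' where f': "f' \<in> carrier (Aut_B n)" "tau n f' = tau n f" "\<And>x. x \<in> D \<Longrightarrow> f' x = f x"
    and f'_displ: "(\<forall>x\<in>D. snd x < snd (f x)) \<and> (\<forall>x\<in>{}. snd x < snd (f x)) \<longrightarrow>
       (\<exists>c>0. \<forall>x\<in>B_poset n. snd x + c \<le> snd (f' x))"
    by (rule amalgamation[OF f(1) f(1) refl D, of "{}"]) simp_all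
  then have f'_displ: "\<exists>c>0. \<forall>x\<in>B_poset n. snd x + c \<le> snd (f' x)"
    using f(2) by simp
  have f'_plus: "f' \<in> Aut_plus_B n"
    by (rule Aut_plus_BI[OF f'(1) f'_displ])
  have X': "(f', g) \<in> X_set n"
    by (rule X_set_change[OF X f'_plus g f'(2) refl])
  from f'_displ obtain c where c: "c > 0" "\<And>x. x \<in> B_poset n \<Longrightarrow> snd x + c \<le> snd (f' x)"
    by auto
  define \<rho> where "\<rho> = inv\<^bsub>sym_group n\<^esub> (tau n g) \<otimes>\<^bsub>sym_group n\<^esub> tau n h"
  have \<rho>: "\<rho> \<in> carrier (sym_group n)"
    unfolding \<rho>_def by (intro H.m_closed H.inv_closed hom_closed h g)
  obtain v where v: "v \<in> generate (Aut_B n) {f', g}" "v \<in> carrier (Aut_B n)" "tau n v = \<rho>"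
    by (rule generate_covers_permutations[OF X' \<rho>[unfolded sym_group_carrier]])
  obtain \<Phi> where \<Phi>: "finitely_determined n \<Phi>" "\<Phi> f' g = v"
      "\<And>f' g'. \<Phi> f' g' \<in> generate (Aut_B n) {f', g'}"
    by (rule generate_finitely_determined[OF v(1)]) blast
  obtain P where P: "finite P" "P \<subseteq> B_poset n"
    "\<And>f'' g' x. f'' \<in> carrier (Aut_B n) \<Longrightarrow> g' \<in> carrier (Aut_B n) \<Longrightarrow>
       (\<And>y. y \<in> P \<Longrightarrow> f'' y = f' y \<and> g' y = g y) \<Longrightarrow> x \<in> E \<Longrightarrow> \<Phi> f'' g' x = \<Phi> f' g x"
    by (rule finitely_determinedE[OF \<Phi>(1) f'(1) g E]) blast
  have DP: "finite (D \<union> P)" "D \<union> P \<subseteq> B_poset n"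
    using D P by auto
  \<comment> \<open>The exponent \<open>N\<close> kills the permutation of columns, so \<open>f'\<close> can be iterated without mixing them.\<close>
  define N where "N = order (sym_group n)"
  have N: "N \<ge> 1"
    unfolding N_def using H.order_gt_0_iff_finite by (simp add: sym_group_def finite_permutations Suc_le_eq)
  obtain T where T: "\<And>p. p \<in> (\<lambda>(x, y). max (snd x) (snd (g x)) - min (snd (v y)) (snd (h y))) ` ((D \<union> P) \<times> E) \<Longrightarrow> p < T"
    by (rule finite_strict_upper_bound[of "(\<lambda>(x, y). max (snd x) (snd (g x)) - min (snd (v y)) (snd (h y))) ` ((D \<union> P) \<times> E)"])
      (use DP E in auto)
  obtain j where j: "T < of_nat j * c"
    using ex_less_of_nat_mult[OF c(1)] by blast
  define R where "R = f' [^]\<^bsub>Aut_B n\<^esub> (N * j)"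
  have R: "R \<in> carrier (Aut_B n)"
    using f'(1) by (simp add: R_def)
  have tau_R: "tau n R = \<one>\<^bsub>sym_group n\<^esub>"
    using f'(1) H.pow_order_eq_1[of "tau n f'"]
    by (simp add: R_def N_def hom_nat_pow H.nat_pow_pow[symmetric])
  have R_displ: "snd x + T < snd (R x)" if "x \<in> B_poset n" for x
  proof -
    have "of_nat j * c \<le> of_nat (N * j) * c"
      using N c(1) by (intro mult_right_mono of_nat_mono) auto
    then show ?thesis
      using iterated_displacement[OF f'(1) c(2) that, of "N * j"] j unfolding R_def by linarith
  qed
  \<comment> \<open>The behaviour prescribed for \<open>g'\<close> far up; by the choice of \<open>\<rho>\<close> it permutes the columns as \<open>g\<close> does.\<close>
  define \<psi> where "\<psi> = R \<otimes>\<^bsub>Aut_B n\<^esub> (h \<otimes>\<^bsub>Aut_B n\<^esub> (inv\<^bsub>Aut_B n\<^esub> v \<otimes>\<^bsub>Aut_B n\<^esub> inv\<^bsub>Aut_B n\<^esub> R))"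
  have \<psi>: "\<psi> \<in> carrier (Aut_B n)"
    using R h v(2) by (simp add: \<psi>_def del: mult_Aut_B)
  have tau_\<psi>: "tau n \<psi> = tau n g"
    using R h v(2,3) g
    by (simp add: \<psi>_def \<rho>_def tau_R H.inv_mult_group H.m_assoc[symmetric]
        del: mult_Aut_B sym_group_inv_equality)
  have \<psi>_apply: "\<psi> (R (v x)) = R (h x)" for x
    by (simp add: \<psi>_def Aut_B_inv_apply[OF R] Aut_B_inv_apply[OF v(2)])
  define E' where "E' = (\<lambda>x. R (v x)) ` E"
  have E': "finite E'" "E' \<subseteq> B_poset n"
    unfolding E'_def using E(1)
    by (simp, intro image_subsetI Aut_B_closed[OF R] Aut_B_closed[OF v(2)] subsetD[OF E(2)])
  have above: "snd x < snd y \<and> snd (g x) < snd (\<psi> y)" if x: "x \<in> D \<union> P" and y: "y \<in> E'" for x y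
  proof -
    obtain e where e: "e \<in> E" "y = R (v e)"
      using y by (auto simp: E'_def)
    have eB: "v e \<in> B_poset n" "h e \<in> B_poset n"
      by (intro Aut_B_closed[OF v(2)] Aut_B_closed[OF h] subsetD[OF E(2)] e(1))+
    have "max (snd x) (snd (g x)) - min (snd (v e)) (snd (h e)) < T"
      by (rule T) (use x e in force)
    then show ?thesis
      using R_displ[OF eB(1)] R_displ[OF eB(2)] by (simp add: e(2) \<psi>_apply) linarith
  qed
  obtain g' where g': "g' \<in> carrier (Aut_B n)" "tau n g' = tau n g"
      "\<And>x. x \<in> D \<union> P \<Longrightarrow> g' x = g x" "\<And>x. x \<in> E' \<Longrightarrow> g' x = \<psi> x"
    by (rule amalgamation[OF g \<psi> tau_\<psi> DP E' above]) simp_all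
  define u where "u = inv\<^bsub>Aut_B n\<^esub> R \<otimes>\<^bsub>Aut_B n\<^esub> (g' \<otimes>\<^bsub>Aut_B n\<^esub> (R \<otimes>\<^bsub>Aut_B n\<^esub> \<Phi> f' g'))"
  show thesis
  proof (rule that)
    show "(f', g') \<in> X_set n"
      by (rule X_set_change[OF X f'_plus g'(1) f'(2) g'(2)])
    show "f' x = f x \<and> g' x = g x" if "x \<in> D" for x
      using that f'(3) g'(3) by simp
    interpret gen: subgroup "generate (Aut_B n) {f', g'}" "Aut_B n"
      by (rule G.generate_is_subgroup) (use f' g' in auto)
    have f'g': "f' \<in> generate (Aut_B n) {f', g'}" "g' \<in> generate (Aut_B n) {f', g'}"
      by (simp_all add: generate.incl)
    have "R \<in> generate (Aut_B n) {f', g'}"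
      using G.subgroup_int_pow_closed[OF gen.subgroup_axioms f'g'(1), of "int (N * j)"]
      by (simp only: R_def int_pow_int)
    then show "u \<in> generate (Aut_B n) {f', g'}"
      unfolding u_def by (intro gen.m_closed gen.m_inv_closed f'g' \<Phi>(3))
    show "u x = h x" if "x \<in> E" for x
    proof -
      have "\<Phi> f' g' x = v x"
        using P(3)[OF f'(1) g'(1) _ that] g'(3) \<Phi>(2) by simp
      moreover have "g' (R (v x)) = R (h x)"
        using g'(4)[of "R (v x)"] that \<psi>_apply by (simp add: E'_def)
      ultimately show ?thesis
        by (simp add: u_def Aut_B_inv_apply[OF R])
    qed
  qed
qed

section \<open>Making a word nontrivial\<close>

text \<open>
  A ping-pong pair with the column permutations of \<open>f\<close> and \<open>g\<close> shows \<open>w\<close> to be nontrivial, and it does so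
  on a finite set \<open>P\<close>. Conjugating by a large upward shift \<open>\<theta>\<close> moves this finite configuration above the
  values that have to be kept, where it can be amalgamated with \<open>f\<close> and \<open>g\<close>.
\<close>

lemma free_extension:
  assumes X: "(f, g) \<in> X_set n" and D: "finite D" "D \<subseteq> B_poset n"
    and w: "irreducible_word w" and n: "n \<ge> 1"
  obtains f' g' where "(f', g') \<in> X_set n" "\<And>x. x \<in> D \<Longrightarrow> f' x = f x \<and> g' x = g x"
    "eval_word (Aut_B n) f' g' w \<noteq> \<one>\<^bsub>Aut_B n\<^esub>"
proof -
  interpret group_hom "Aut_B n" "sym_group n" "tau n"
    by (rule tau_group_hom)
  have f: "f \<in> carrier (Aut_B n)" "\<And>x. x \<in> D \<Longrightarrow> snd x < snd (f x)" and g: "g \<in> carrier (Aut_B n)"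
    using X D by (auto simp: X_set_def Aut_plus_B_def)
  obtain f0 g0 x0 where f0: "f0 \<in> carrier (Aut_B n)" "tau n f0 = tau n f"
      "\<And>x. x \<in> B_poset n \<Longrightarrow> snd x < snd (f0 x)"
    and g0: "g0 \<in> carrier (Aut_B n)" "tau n g0 = tau n g"
    and x0: "x0 \<in> B_poset n" "eval_word (Aut_B n) f0 g0 w x0 \<noteq> x0"
    by (rule ping_pong_pair[OF w n tau_permutes[OF f(1)] tau_permutes[OF g]]) (rule that)
  obtain P where P: "finite P" "P \<subseteq> B_poset n"
    "\<And>f' g' x. f' \<in> carrier (Aut_B n) \<Longrightarrow> g' \<in> carrier (Aut_B n) \<Longrightarrow>
       (\<And>y. y \<in> P \<Longrightarrow> f' y = f0 y \<and> g' y = g0 y) \<Longrightarrow> x \<in> {x0} \<Longrightarrow>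
       eval_word (Aut_B n) f' g' w x = eval_word (Aut_B n) f0 g0 w x"
    by (rule finitely_determinedE[OF finitely_determined_eval_word f0(1) g0(1), of "{x0}"])
      (use x0 in auto)
  define S where "S = (\<lambda>(x, y). snd x - snd y) ` (D \<times> P)
    \<union> (\<lambda>(x, y). snd (f x) - snd (f0 y)) ` (D \<times> P) \<union> (\<lambda>(x, y). snd (g x) - snd (g0 y)) ` (D \<times> P)"
  have "finite S"
    using D P by (simp add: S_def)
  then obtain T where T: "\<And>p. p \<in> S \<Longrightarrow> p < T"
    by (rule finite_strict_upper_bound) (rule that)
  have T_above: "snd x < snd y + T" "snd (f x) < snd (f0 y) + T" "snd (g x) < snd (g0 y) + T"
    if "x \<in> D" "y \<in> P" for x y
  proof -
    have "snd x - snd y \<in> S" "snd (f x) - snd (f0 y) \<in> S" "snd (g x) - snd (g0 y) \<in> S"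
      using that by (force simp: S_def)+
    then have "snd x - snd y < T" "snd (f x) - snd (f0 y) < T" "snd (g x) - snd (g0 y) < T"
      by (simp_all add: T)
    then show "snd x < snd y + T" "snd (f x) < snd (f0 y) + T" "snd (g x) < snd (g0 y) + T"
      by linarith+
  qed
  define \<theta> where "\<theta> = column_map n id (\<lambda>_ p. p + T)"
  have \<theta>: "\<theta> \<in> carrier (Aut_B n)" and tau_\<theta>: "tau n \<theta> = \<one>\<^bsub>sym_group n\<^esub>"
    unfolding \<theta>_def sym_group_one using column_map_Aut_B[OF permutes_id shift_increasing_bij] by auto
  have snd_\<theta>: "snd (\<theta> x) = snd x + T" if "x \<in> B_poset n" for x
    using that by (simp add: \<theta>_def column_map_def)
  define lift where "lift k = \<theta> \<otimes>\<^bsub>Aut_B n\<^esub> (k \<otimes>\<^bsub>Aut_B n\<^esub> inv\<^bsub>Aut_B n\<^esub> \<theta>)" for k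
  have lift: "lift k \<in> carrier (Aut_B n)" "tau n (lift k) = tau n k" if "k \<in> carrier (Aut_B n)" for k
    using that \<theta> by (simp_all add: lift_def tau_\<theta> del: mult_Aut_B)
  have lift_apply: "lift k (\<theta> x) = \<theta> (k x)" for k x
    by (simp add: lift_def Aut_B_inv_apply[OF \<theta>])
  have P': "finite (\<theta> ` P)" "\<theta> ` P \<subseteq> B_poset n"
    using P(1) by (simp, intro image_subsetI Aut_B_closed[OF \<theta>] subsetD[OF P(2)])
  have snd_lift: "snd (lift k (\<theta> y)) = snd (k y) + T" if "k \<in> carrier (Aut_B n)" "y \<in> P" for k y
    using that P(2) snd_\<theta> Aut_B_closed by (simp add: lift_apply subset_eq)
  have f_above: "snd x < snd y \<and> snd (f x) < snd (lift f0 y)" if "x \<in> D" "y \<in> \<theta> ` P" for x y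
  proof -
    obtain z where z: "z \<in> P" "y = \<theta> z"
      using \<open>y \<in> \<theta> ` P\<close> by (rule imageE)
    show ?thesis
      using T_above[OF \<open>x \<in> D\<close> z(1)] snd_\<theta>[OF subsetD[OF P(2) z(1)]]
      by (simp add: z(2) snd_lift[OF f0(1) z(1)])
  qed
  have g_above: "snd x < snd y \<and> snd (g x) < snd (lift g0 y)" if "x \<in> D" "y \<in> \<theta> ` P" for x y
  proof -
    obtain z where z: "z \<in> P" "y = \<theta> z"
      using \<open>y \<in> \<theta> ` P\<close> by (rule imageE)
    show ?thesis
      using T_above[OF \<open>x \<in> D\<close> z(1)] snd_\<theta>[OF subsetD[OF P(2) z(1)]]
      by (simp add: z(2) snd_lift[OF g0(1) z(1)])
  qed
  have f0_displ: "\<forall>y\<in>\<theta> ` P. snd y < snd (lift f0 y)"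
  proof
    fix y assume "y \<in> \<theta> ` P"
    then obtain z where z: "z \<in> P" "y = \<theta> z"
      by (rule imageE)
    have "z \<in> B_poset n"
      by (rule subsetD[OF P(2) z(1)])
    then show "snd y < snd (lift f0 y)"
      using f0(3) by (simp add: z(2) snd_lift[OF f0(1) z(1)] snd_\<theta>)
  qed
  have tau_lift: "tau n (lift f0) = tau n f" "tau n (lift g0) = tau n g"
    using f0 g0 lift by simp_all
  obtain f' where f': "f' \<in> carrier (Aut_B n)" "tau n f' = tau n f" "\<And>x. x \<in> D \<Longrightarrow> f' x = f x"
      "\<And>y. y \<in> \<theta> ` P \<Longrightarrow> f' y = lift f0 y"
      "(\<forall>x\<in>D. snd x < snd (f x)) \<and> (\<forall>y\<in>\<theta> ` P. snd y < snd (lift f0 y)) \<longrightarrow>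
       (\<exists>c>0. \<forall>x\<in>B_poset n. snd x + c \<le> snd (f' x))"
    by (rule amalgamation[OF f(1) lift(1)[OF f0(1)] tau_lift(1) D P' f_above]) (assumption, assumption, rule that)
  then have f'_plus: "f' \<in> Aut_plus_B n"
    using f(2) f0_displ by (intro Aut_plus_BI) simp_all
  obtain g' where g': "g' \<in> carrier (Aut_B n)" "tau n g' = tau n g" "\<And>x. x \<in> D \<Longrightarrow> g' x = g x"
      "\<And>y. y \<in> \<theta> ` P \<Longrightarrow> g' y = lift g0 y"
    by (rule amalgamation[OF g lift(1)[OF g0(1)] tau_lift(2) D P' g_above]) (assumption, assumption, rule that)
  \<comment> \<open>Shifting back, the new pair agrees with the ping-pong pair on \<open>P\<close>.\<close>
  define \<phi> where "\<phi> k = inv\<^bsub>Aut_B n\<^esub> \<theta> \<otimes>\<^bsub>Aut_B n\<^esub> k \<otimes>\<^bsub>Aut_B n\<^esub> \<theta>" for k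
  interpret conj: group_hom "Aut_B n" "Aut_B n" \<phi>
    unfolding \<phi>_def by (rule G.conjugation_group_hom[OF \<theta>])
  have "eval_word (Aut_B n) (\<phi> f') (\<phi> g') w x0 = eval_word (Aut_B n) f0 g0 w x0"
  proof (rule P(3))
    show "\<phi> f' y = f0 y \<and> \<phi> g' y = g0 y" if "y \<in> P" for y
      using that f'(4)[of "\<theta> y"] g'(4)[of "\<theta> y"]
      by (simp add: \<phi>_def lift_apply Aut_B_inv_apply[OF \<theta>])
  qed (use f' g' in auto)
  then have "\<phi> (eval_word (Aut_B n) f' g' w) x0 \<noteq> x0"
    using x0 eval_word_hom(1)[OF conj.group_hom_axioms f'(1) g'(1)] by simp
  then have "eval_word (Aut_B n) f' g' w \<noteq> \<one>\<^bsub>Aut_B n\<^esub>"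
    using conj.hom_one by (metis id_apply one_Aut_B)
  moreover have "(f', g') \<in> X_set n"
    by (rule X_set_change[OF X f'_plus g'(1) f'(2) g'(2)])
  ultimately show thesis
    using that f'(3) g'(3) by simp
qed

section \<open>Comeagerness\<close>

definition word_nontrivial :: "nat \<Rightarrow> (letter \<times> int) list \<Rightarrow>
    ((nat \<times> rat \<Rightarrow> nat \<times> rat) \<times> (nat \<times> rat \<Rightarrow> nat \<times> rat)) set" where
  "word_nontrivial n w = {(f, g) \<in> X_set n. eval_word (Aut_B n) f g w \<noteq> \<one>\<^bsub>Aut_B n\<^esub>}"

definition realizes_graph :: "nat \<Rightarrow> ((nat \<times> rat) \<times> (nat \<times> rat)) list \<Rightarrow>
    ((nat \<times> rat \<Rightarrow> nat \<times> rat) \<times> (nat \<times> rat \<Rightarrow> nat \<times> rat)) set" where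
  "realizes_graph n l = {(f, g) \<in> X_set n.
     \<exists>v\<in>generate (Aut_B n) {f, g}. \<forall>(x, y)\<in>set l. v x = y}"

text \<open>
  Finite pieces of graphs are encoded as lists, of which there are only countably many, although
  there are uncountably many automorphisms.
\<close>

definition automorphism_graphs :: "nat \<Rightarrow> ((nat \<times> rat) \<times> (nat \<times> rat)) list set" where
  "automorphism_graphs n =
     {l. \<exists>h\<in>carrier (Aut_B n). \<forall>(x, y)\<in>set l. x \<in> B_poset n \<and> h x = y}"

text \<open>
  A nontrivial value of \<open>w\<close> is witnessed by a point that it moves, and the image of that point depends on
  finitely many values of the generators.
\<close>

lemma openin_word_nontrivial: "openin (X_top n) (word_nontrivial n w)"
  unfolding openin_X_top_iff
proof (intro conjI ballI, goal_cases)
  case 1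
  show ?case by (auto simp: word_nontrivial_def)
next
  case (2 z)
  obtain f g where z: "z = (f, g)" by force
  have fg: "f \<in> carrier (Aut_B n)" "g \<in> carrier (Aut_B n)"
    using 2 X_set_carrier unfolding word_nontrivial_def z by auto
  let ?v = "eval_word (Aut_B n) f g w"
  have "?v \<noteq> id"
    using 2 by (simp add: z word_nontrivial_def)
  then obtain x where x: "?v x \<noteq> x"
    by (auto simp: fun_eq_iff)
  have "?v permutes B_poset n"
    using finitely_determined_closed[OF finitely_determined_eval_word fg]
    by (auto simp: Aut_B_def order_auts_def)
  then have "x \<in> B_poset n"
    using x by (metis permutes_not_in)
  then obtain P where P: "finite P" "P \<subseteq> B_poset n"
    "\<And>f' g' y. f' \<in> carrier (Aut_B n) \<Longrightarrow> g' \<in> carrier (Aut_B n) \<Longrightarrow>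
       (\<And>y. y \<in> P \<Longrightarrow> f' y = f y \<and> g' y = g y) \<Longrightarrow> y \<in> {x} \<Longrightarrow>
       eval_word (Aut_B n) f' g' w y = ?v y"
    by (rule_tac finitely_determinedE[OF finitely_determined_eval_word fg, of "{x}"]) auto
  have "(f', g') \<in> word_nontrivial n w"
    if "(f', g') \<in> X_set n" "\<forall>x\<in>P. f' x = f x \<and> g' x = g x" for f' g'
  proof -
    have "eval_word (Aut_B n) f' g' w x = ?v x"
      using P(3) X_set_carrier[OF that(1)] that(2) by simp
    then have "eval_word (Aut_B n) f' g' w \<noteq> id"
      using x by auto
    then show ?thesis
      using that(1) by (simp add: word_nontrivial_def)
  qed
  then show ?case
    unfolding z prod.case using P(1,2) by (intro exI[of _ P]) auto
qed

lemma openin_realizes_graph: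
  assumes "l \<in> automorphism_graphs n"
  shows "openin (X_top n) (realizes_graph n l)"
  unfolding openin_X_top_iff
proof (intro conjI ballI, goal_cases)
  case 1
  show ?case by (auto simp: realizes_graph_def)
next
  case (2 z)
  obtain f g where z: "z = (f, g)" by force
  have fg: "f \<in> carrier (Aut_B n)" "g \<in> carrier (Aut_B n)"
    using 2 X_set_carrier unfolding realizes_graph_def z by auto
  from 2 obtain v where v: "v \<in> generate (Aut_B n) {f, g}" "\<forall>(x, y)\<in>set l. v x = y"
    by (auto simp: z realizes_graph_def)
  obtain \<Phi> where \<Phi>: "finitely_determined n \<Phi>" "\<Phi> f g = v"
      "\<And>f' g'. \<Phi> f' g' \<in> generate (Aut_B n) {f', g'}"
    by (rule generate_finitely_determined[OF v(1)]) blast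
  have E: "finite (fst ` set l)" "fst ` set l \<subseteq> B_poset n"
    using assms by (auto simp: automorphism_graphs_def)
  obtain P where P: "finite P" "P \<subseteq> B_poset n"
    "\<And>f' g' y. f' \<in> carrier (Aut_B n) \<Longrightarrow> g' \<in> carrier (Aut_B n) \<Longrightarrow>
       (\<And>y. y \<in> P \<Longrightarrow> f' y = f y \<and> g' y = g y) \<Longrightarrow> y \<in> fst ` set l \<Longrightarrow>
       \<Phi> f' g' y = \<Phi> f g y"
    by (rule finitely_determinedE[OF \<Phi>(1) fg E]) blast
  have "(f', g') \<in> realizes_graph n l"
    if "(f', g') \<in> X_set n" "\<forall>x\<in>P. f' x = f x \<and> g' x = g x" for f' g'
  proof -
    have "\<Phi> f' g' x = v x" if "x \<in> fst ` set l" for x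
      using P(3)[OF X_set_carrier[OF \<open>(f', g') \<in> X_set n\<close>] _ that]
        \<open>\<forall>x\<in>P. f' x = f x \<and> g' x = g x\<close> \<Phi>(2) by simp
    then have "\<forall>(x, y)\<in>set l. \<Phi> f' g' x = y"
      using v(2) by force
    then show ?thesis
      using that(1) \<Phi>(3) unfolding realizes_graph_def by auto
  qed
  then show ?case
    unfolding z prod.case using P(1,2) by (intro exI[of _ P]) auto
qed

lemma X_top_basic_neighbourhood:
  assumes "openin (X_top n) W" "W \<noteq> {}"
  obtains f g D where "(f, g) \<in> X_set n" "finite D" "D \<subseteq> B_poset n"
    "\<And>f' g'. (f', g') \<in> X_set n \<Longrightarrow> \<forall>x\<in>D. f' x = f x \<and> g' x = g x \<Longrightarrow> (f', g') \<in> W"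
proof -
  obtain f g where fg: "(f, g) \<in> W"
    using assms(2) by auto
  note W = assms(1)[unfolded openin_X_top_iff]
  from bspec[OF conjunct2[OF W] fg, unfolded prod.case]
  obtain D where D: "finite D" "D \<subseteq> B_poset n"
    "\<forall>(f', g')\<in>X_set n. (\<forall>x\<in>D. f' x = f x \<and> g' x = g x) \<longrightarrow> (f', g') \<in> W"
    by (elim exE conjE)
  show thesis
  proof (rule that[OF _ D(1,2)])
    show "(f, g) \<in> X_set n"
      using subsetD[OF conjunct1[OF W] fg] .
    show "(f', g') \<in> W" if "(f', g') \<in> X_set n" "\<forall>x\<in>D. f' x = f x \<and> g' x = g x" for f' g'
      using D(3) that by auto
  qed
qed

lemma word_nontrivial_dense:
  assumes "irreducible_word w" "n \<ge> 1" "openin (X_top n) W" "W \<noteq> {}"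
  shows "word_nontrivial n w \<inter> W \<noteq> {}"
proof -
  obtain f g D where fg: "(f, g) \<in> X_set n" "finite D" "D \<subseteq> B_poset n"
    "\<And>f' g'. (f', g') \<in> X_set n \<Longrightarrow> \<forall>x\<in>D. f' x = f x \<and> g' x = g x \<Longrightarrow> (f', g') \<in> W"
    by (rule X_top_basic_neighbourhood[OF assms(3,4)]) (rule that)
  obtain f' g' where "(f', g') \<in> X_set n" "\<And>x. x \<in> D \<Longrightarrow> f' x = f x \<and> g' x = g x"
    "eval_word (Aut_B n) f' g' w \<noteq> \<one>\<^bsub>Aut_B n\<^esub>"
    by (rule free_extension[OF fg(1-3) assms(1,2)]) (rule that)
  then have "(f', g') \<in> word_nontrivial n w \<inter> W"
    using fg(4) by (simp add: word_nontrivial_def)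
  then show ?thesis by auto
qed

lemma realizes_graph_dense:
  assumes "l \<in> automorphism_graphs n" "openin (X_top n) W" "W \<noteq> {}"
  shows "realizes_graph n l \<inter> W \<noteq> {}"
proof -
  obtain f g D where fg: "(f, g) \<in> X_set n" "finite D" "D \<subseteq> B_poset n"
    "\<And>f' g'. (f', g') \<in> X_set n \<Longrightarrow> \<forall>x\<in>D. f' x = f x \<and> g' x = g x \<Longrightarrow> (f', g') \<in> W"
    by (rule X_top_basic_neighbourhood[OF assms(2,3)]) (rule that)
  obtain h where h: "h \<in> carrier (Aut_B n)" "\<forall>(x, y)\<in>set l. x \<in> B_poset n \<and> h x = y"
    using assms(1) by (auto simp: automorphism_graphs_def)
  have E: "finite (fst ` set l)" "fst ` set l \<subseteq> B_poset n"
    using h(2) by auto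
  obtain f' g' v where v: "(f', g') \<in> X_set n" "\<And>x. x \<in> D \<Longrightarrow> f' x = f x \<and> g' x = g x"
    "v \<in> generate (Aut_B n) {f', g'}" "\<And>x. x \<in> fst ` set l \<Longrightarrow> v x = h x"
    by (rule dense_generating_extension[OF fg(1-3) h(1) E]) (rule that)
  have "\<forall>(x, y)\<in>set l. v x = y"
    using v(4) h(2) by force
  then have "(f', g') \<in> realizes_graph n l \<inter> W"
    using v(1-3) fg(4) by (auto simp: realizes_graph_def)
  then show ?thesis by auto
qed

lemma generate_dense_if_realizes_graphs:
  assumes fg: "(f, g) \<in> X_set n"
    and real: "\<And>l. l \<in> automorphism_graphs n \<Longrightarrow> (f, g) \<in> realizes_graph n l"
  shows "Abstract_Topology.closure_of (Aut_B_top n) (generate (Aut_B n) {f, g}) = topspace (Aut_B_top n)"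
proof (intro equalityI closure_of_subset_topspace subsetI)
  fix h assume "h \<in> topspace (Aut_B_top n)"
  then have h: "h \<in> carrier (Aut_B n)"
    by simp
  have "\<exists>v. v \<in> generate (Aut_B n) {f, g} \<and> v \<in> U" if U: "h \<in> U" "openin (Aut_B_top n) U" for U
  proof -
    from U(2)[unfolded openin_Aut_B_iff, THEN conjunct2, THEN bspec, OF U(1)]
    obtain D where D: "finite D" "D \<subseteq> B_poset n"
        "\<forall>h'\<in>carrier (Aut_B n). (\<forall>x\<in>D. h' x = h x) \<longrightarrow> h' \<in> U"
      by (elim exE conjE)
    obtain xs where xs: "set xs = D"
      using finite_list[OF D(1)] by auto
    have "map (\<lambda>x. (x, h x)) xs \<in> automorphism_graphs n"
      using h D(2) xs unfolding automorphism_graphs_def by auto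
    from real[OF this] obtain v where v: "v \<in> generate (Aut_B n) {f, g}" "\<forall>x\<in>D. v x = h x"
      by (auto simp: realizes_graph_def xs)
    have "v \<in> carrier (Aut_B n)"
      using group.generate_in_carrier[OF group_Aut_B _ v(1)] X_set_carrier[OF fg] by auto
    then show ?thesis
      using v D(3) by auto
  qed
  then show "h \<in> Abstract_Topology.closure_of (Aut_B_top n) (generate (Aut_B n) {f, g})"
    using h by (auto simp: in_closure_of)
qed

instance letter :: countable
  by countable_datatype

theorem corollary3p14:
  fixes n :: nat
  assumes "n \<ge> 1"
  shows "comeager_in (X_top n)
    {(f, g) \<in> X_set n. freely_generate_dense (Aut_B n) (Aut_B_top n) f g}"
proof (rule comeager_inI)
  let ?O = "word_nontrivial n ` {w. irreducible_word w} \<union> realizes_graph n ` automorphism_graphs n"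
  show "{(f, g) \<in> X_set n. freely_generate_dense (Aut_B n) (Aut_B_top n) f g} \<subseteq> topspace (X_top n)"
    by auto
  show "countable ?O"
    by (intro countable_Un countable_image countableI_type)
  show "openin (X_top n) V" if "V \<in> ?O" for V
    using that openin_word_nontrivial openin_realizes_graph by auto
  show "V \<inter> W \<noteq> {}" if "V \<in> ?O" "openin (X_top n) W" "W \<noteq> {}" for V W
    using that(1) word_nontrivial_dense[OF _ assms that(2,3)] realizes_graph_dense[OF _ that(2,3)]
    by (elim UnE imageE) simp_all
  show "topspace (X_top n) \<inter> \<Inter>?O
      \<subseteq> {(f, g) \<in> X_set n. freely_generate_dense (Aut_B n) (Aut_B_top n) f g}"
  proof
    fix z assume z: "z \<in> topspace (X_top n) \<inter> \<Inter>?O"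
    obtain f g where z_eq: "z = (f, g)"
      by force
    have fg: "(f, g) \<in> X_set n"
      and free: "\<And>w. irreducible_word w \<Longrightarrow> (f, g) \<in> word_nontrivial n w"
      and real: "\<And>l. l \<in> automorphism_graphs n \<Longrightarrow> (f, g) \<in> realizes_graph n l"
      using z unfolding z_eq by auto
    have "freely_generate_dense (Aut_B n) (Aut_B_top n) f g"
      unfolding freely_generate_dense_def
    proof (intro conjI allI impI)
      show "eval_word (Aut_B n) f g w \<noteq> \<one>\<^bsub>Aut_B n\<^esub>" if "irreducible_word w" for w
        using free[OF that] by (simp add: word_nontrivial_def)
      show "Abstract_Topology.closure_of (Aut_B_top n) (generate (Aut_B n) {f, g}) = topspace (Aut_B_top n)"
        by (rule generate_dense_if_realizes_graphs[OF fg real])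
    qed
    then show "z \<in> {(f, g) \<in> X_set n. freely_generate_dense (Aut_B n) (Aut_B_top n) f g}"
      using fg by (simp add: z_eq)
  qed
qed

end
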